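(* Let $G$ be a $2$-connected graph which is $K_{1,3}$-free and $K_4$-minor-free. Then $G$ is outerplanar. Furthermore, $G$ is isomorphic to $\mathcal{Z}_d$ or $\mathcal{Z}^*_d$ for some $d\ge1$, or to a graph in $\mathcal{S}_t$ for some $t\ge3$.
   Context: All graphs are finite, simple and undirected. $G$ is $H$-free if it has no induced subgraph isomorphic to $H$; $H$-minor-free if it has no minor isomorphic to $H$. For $d\ge1$, $\mathcal{L}_d$ is the graph obtained from a path $v_0v_1\cdots v_{2d}$ by adding the edges $v_iv_{2d-i}$ for $i\in\{0,\dots,d-1\}$; $\mathcal{Z}_d$ is obtained from $\mathcal{L}_d$ by further adding the edges $v_iv_{2d-1-i}$ for $i\in\{0,\dots,d-2\}$; $\mathcal{Z}^*_d$ is $\mathcal{Z}_d$ with the vertex $v_d$ deleted. For $t\ge3$, $\mathcal{S}_t$ is the set of graphs obtained from a cycle $v_0v_1\cdots v_{t-1}v_0$ by choosing any subset $I\subseteq\{0,\dots,t-1\}$ and, for each $i\in I$, adding a new vertex $r_i$ adjacent exactly to $v_i$ and $v_{i+1}$ (indices modulo $t$). *)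

theory Defs
  imports "HOL-Analysis.Analysis" "Graph_Theory.Graph_Theory"
begin

text \<open>
  Finite simple undirected graphs are the symmetric loop-free finite pair digraphs
  (locale \<^locale>\<open>pair_graph\<close>): an edge \<open>uv\<close> is the pair of arcs \<open>(u,v)\<close>, \<open>(v,u)\<close>.
\<close>

definition k_connected :: "nat \<Rightarrow> ('a,'b) pre_digraph \<Rightarrow> bool" where
  "k_connected k G \<longleftrightarrow> k < card (verts G) \<and>
    (\<forall>X \<subseteq> verts G. card X < k \<longrightarrow> Digraph_Component.connected (G \<restriction> (verts G - X)))"

definition induced_free :: "('c,'d) pre_digraph \<Rightarrow> ('a,'b) pre_digraph \<Rightarrow> bool" where
  "induced_free H G \<longleftrightarrow> \<not> (\<exists>S. induced_subgraph S G \<and> digraph_iso S H)"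

text \<open>
  \<open>H\<close> is (isomorphic to) a minor of \<open>G\<close>: a graph isomorphic to \<open>H\<close> arises from a subgraph of
  \<open>G\<close> by contracting the pairwise disjoint connected branch sets \<open>B x\<close> to single vertices. Note
  that \<^const>\<open>Digraph_Component.connected\<close> entails that branch sets are nonempty.
\<close>

definition minor :: "('c,'d) pre_digraph \<Rightarrow> ('a,'b) pre_digraph \<Rightarrow> bool" where
  "minor H G \<longleftrightarrow> (\<exists>B :: 'c \<Rightarrow> 'a set.
    (\<forall>x \<in> verts H. B x \<subseteq> verts G \<and> Digraph_Component.connected (G \<restriction> B x)) \<and>
    (\<forall>x \<in> verts H. \<forall>y \<in> verts H. x \<noteq> y \<longrightarrow> B x \<inter> B y = {}) \<and>
    (\<forall>(x,y) \<in> arcs_ends H. \<exists>u \<in> B x. \<exists>v \<in> B y. u \<rightarrow>\<^bsub>G\<^esub> v))"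

definition minor_free :: "('c,'d) pre_digraph \<Rightarrow> ('a,'b) pre_digraph \<Rightarrow> bool" where
  "minor_free H G \<longleftrightarrow> \<not> minor H G"

text \<open>
  The vertices are drawn as the distinct points \<open>p v\<close> of the plane, and the edge \<open>uv\<close> as the
  point set \<open>c {u,v}\<close>, an arc between \<open>p u\<close> and \<open>p v\<close>. No arc meets a vertex other than its ends,
  and two different arcs meet only in vertices, hence only in common ends.
\<close>

definition plane_embedding ::
    "'a pair_pre_digraph \<Rightarrow> ('a \<Rightarrow> complex) \<Rightarrow> ('a set \<Rightarrow> complex set) \<Rightarrow> bool" where
  "plane_embedding G p c \<longleftrightarrow>
    inj_on p (pverts G) \<and>
    (\<forall>(u,v) \<in> parcs G.
       (\<exists>g. arc g \<and> path_image g = c {u,v} \<and> pathstart g = p u \<and> pathfinish g = p v) \<and>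
       c {u,v} \<inter> p ` pverts G = {p u, p v}) \<and>
    (\<forall>(u,v) \<in> parcs G. \<forall>(x,y) \<in> parcs G.
       {u,v} \<noteq> {x,y} \<longrightarrow> c {u,v} \<inter> c {x,y} \<subseteq> p ` pverts G)"

definition drawing ::
    "'a pair_pre_digraph \<Rightarrow> ('a \<Rightarrow> complex) \<Rightarrow> ('a set \<Rightarrow> complex set) \<Rightarrow> complex set" where
  "drawing G p c = p ` pverts G \<union> (\<Union>(u,v) \<in> parcs G. c {u,v})"

text \<open>
  As the drawing of a finite graph is compact, its complement has exactly one unbounded
  component, so \<^const>\<open>outside\<close> of the drawing is its outer face.
\<close>

definition outerplanar :: "'a pair_pre_digraph \<Rightarrow> bool" where
  "outerplanar G \<longleftrightarrow> (\<exists>p c. plane_embedding G p c \<and>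
     p ` pverts G \<subseteq> frontier (outside (drawing G p c)))"

definition complete_graph :: "nat \<Rightarrow> nat pair_pre_digraph" where
  "complete_graph n = \<lparr> pverts = {..<n}, parcs = {(i,j). i < n \<and> j < n \<and> i \<noteq> j} \<rparr>"

definition complete_bipartite_graph :: "nat \<Rightarrow> nat \<Rightarrow> nat pair_pre_digraph" where
  "complete_bipartite_graph m n =
    \<lparr> pverts = {..<m+n}, parcs = ({..<m} \<times> {m..<m+n})\<^sup>s \<rparr>"

definition graph_L :: "nat \<Rightarrow> nat pair_pre_digraph" where
  "graph_L d = \<lparr> pverts = {0..2*d},
     parcs = ({(i, i+1) | i. i < 2*d} \<union> {(i, 2*d - i) | i. i < d})\<^sup>s \<rparr>"

text \<open>
  The condition \<open>i + 2 \<le> d\<close> expresses \<open>i \<in> {0,\<dots>,d-2}\<close>, which is empty for \<open>d = 1\<close>.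
\<close>

definition graph_Z :: "nat \<Rightarrow> nat pair_pre_digraph" where
  "graph_Z d = \<lparr> pverts = pverts (graph_L d),
     parcs = parcs (graph_L d) \<union> {(i, 2*d - 1 - i) | i. i + 2 \<le> d}\<^sup>s \<rparr>"

definition graph_Zstar :: "nat \<Rightarrow> (nat, nat \<times> nat) pre_digraph" where
  "graph_Zstar d = pre_digraph.del_vert (with_proj (graph_Z d)) d"

text \<open>
  \<open>Inl i\<close> is the cycle vertex \<open>v\<^sub>i\<close> and \<open>Inr i\<close> the additional vertex \<open>r\<^sub>i\<close>.
\<close>

definition sun_graph :: "nat \<Rightarrow> nat set \<Rightarrow> (nat + nat) pair_pre_digraph" where
  "sun_graph t I = \<lparr> pverts = Inl ` {..<t} \<union> Inr ` I,
     parcs = ({(Inl i, Inl ((i+1) mod t)) | i. i < t} \<union>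
              {(Inr i, Inl i) | i. i \<in> I} \<union>
              {(Inr i, Inl ((i+1) mod t)) | i. i \<in> I})\<^sup>s \<rparr>"

definition graphs_S :: "nat \<Rightarrow> (nat + nat) pair_pre_digraph set" where
  "graphs_S t = {sun_graph t I | I. I \<subseteq> {..<t}}"

lemma complete_graph_K: "K\<^bsub>n\<^esub> (with_proj (complete_graph n))"
  by (auto simp: complete_digraph_pair_def complete_graph_def)

lemma complete_bipartite_graph_K: "K\<^bsub>m,n\<^esub> (with_proj (complete_bipartite_graph m n))"
  unfolding complete_bipartite_digraph_pair_def complete_bipartite_graph_def
proof (intro conjI exI)
  show "pverts \<lparr> pverts = {..<m+n}, parcs = ({..<m} \<times> {m..<m+n})\<^sup>s \<rparr> = {..<m} \<union> {m..<m+n}"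
    by auto
  show "parcs \<lparr> pverts = {..<m+n}, parcs = ({..<m} \<times> {m..<m+n})\<^sup>s \<rparr> =
      {..<m} \<times> {m..<m+n} \<union> {m..<m+n} \<times> {..<m}"
    by (auto simp: symcl_def)
qed auto

lemma pair_graph_Z: "pair_graph (graph_Z d)"
proof -
  have fin: "finite (parcs (graph_Z d))"
    by (rule finite_subset[of _ "{0..2*d} \<times> {0..2*d}"])
       (auto simp: graph_Z_def graph_L_def symcl_def)
  show ?thesis
    by unfold_locales
       (use fin in \<open>auto simp: graph_Z_def graph_L_def symcl_def symmetric_def sym_def\<close>)
qed

lemma pair_graph_S:
  assumes "t \<ge> 3" "H \<in> graphs_S t"
  shows "pair_graph H"
proof -
  obtain I where I: "I \<subseteq> {..<t}" "H = sun_graph t I"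
    using assms(2) by (auto simp: graphs_S_def)
  have "finite I"
    using I(1) finite_subset by blast
  then have fin: "finite (pverts H)"
    by (simp add: I(2) sun_graph_def)
  have sub: "parcs H \<subseteq> pverts H \<times> pverts H"
    using I assms(1) by (auto simp: sun_graph_def symcl_def)
  have loop: "fst e \<noteq> snd e" if "e \<in> parcs H" for e
    using that I assms(1) by (auto simp: sun_graph_def symcl_def mod_Suc split: if_splits)
  show ?thesis
  proof unfold_locales
    show "finite (parcs H)"
      using fin sub by (meson finite_SigmaI finite_subset)
    show "symmetric (with_proj H)"
      by (auto simp: I(2) sun_graph_def symcl_def symmetric_def sym_def)
  qed (use fin sub loop in auto)
qed

lemma digraph_iso_pair_iff:
  assumes "pair_graph G" "pair_graph H"
  shows "digraph_iso (with_proj G) (with_proj H) \<longleftrightarrow>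
    (\<exists>f. bij_betw f (pverts G) (pverts H) \<and>
      (\<forall>u \<in> pverts G. \<forall>v \<in> pverts G. (u,v) \<in> parcs G \<longleftrightarrow> (f u, f v) \<in> parcs H))"
    (is "?L \<longleftrightarrow> ?R")
proof
  interpret G: pair_graph G by fact
  assume ?L
  then obtain h where h: "pre_digraph.digraph_isomorphism (with_proj G) h"
      and H: "with_proj H = app_iso h (with_proj G)"
    by (auto simp: digraph_iso_def)
  let ?f = "iso_verts h"
  have V: "pverts H = ?f ` pverts G"
    using arg_cong[OF H, of verts] by simp
  have A: "parcs H = iso_arcs h ` parcs G"
    using arg_cong[OF H, of arcs] by simp
  have th: "iso_tail h = fst" "iso_head h = snd"
    using arg_cong[OF H, of tail] arg_cong[OF H, of head] by simp_all
  have inj: "inj_on ?f (pverts G)"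
    using h by (simp add: G.digraph_isomorphism_def)
  have A': "iso_arcs h (u,v) = (?f u, ?f v)" if "(u,v) \<in> parcs G" for u v
    using h that th by (auto simp: G.digraph_isomorphism_def intro: prod_eqI)
  have "(u,v) \<in> parcs G \<longleftrightarrow> (?f u, ?f v) \<in> parcs H"
    if uv: "u \<in> pverts G" "v \<in> pverts G" for u v
  proof
    assume "(u,v) \<in> parcs G"
    then show "(?f u, ?f v) \<in> parcs H"
      unfolding A by (rule rev_image_eqI) (simp add: A' \<open>(u,v) \<in> parcs G\<close>)
  next
    assume "(?f u, ?f v) \<in> parcs H"
    then obtain a b where ab: "(a,b) \<in> parcs G" "(?f u, ?f v) = iso_arcs h (a,b)"
      unfolding A by auto
    then have "?f u = ?f a" "?f v = ?f b" "a \<in> pverts G" "b \<in> pverts G"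
      using A'[OF ab(1)] G.wellformed' by auto
    then show "(u,v) \<in> parcs G"
      using ab(1) inj_onD[OF inj] uv by metis
  qed
  then show ?R
    using V inj by (intro exI[of _ ?f]) (auto simp: bij_betw_def)
next
  interpret G: pair_graph G by fact
  interpret H: pair_graph H by fact
  assume ?R
  then obtain f where f: "bij_betw f (pverts G) (pverts H)"
      "\<forall>u \<in> pverts G. \<forall>v \<in> pverts G. (u,v) \<in> parcs G \<longleftrightarrow> (f u, f v) \<in> parcs H"
    by auto
  let ?h = "\<lparr> iso_verts = f, iso_arcs = map_prod f f, iso_head = snd, iso_tail = fst \<rparr>"
  have inj: "inj_on f (pverts G)" and V: "f ` pverts G = pverts H"
    using f(1) by (auto simp: bij_betw_def)
  have "inj_on (map_prod f f) (parcs G)"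
    by (rule inj_on_subset[OF map_prod_inj_on[OF inj inj]]) (auto dest: G.wellformed')
  then have iso: "pre_digraph.digraph_isomorphism (with_proj G) ?h"
    using inj G.wf_digraph_axioms by (auto simp: G.digraph_isomorphism_def)
  have "parcs H \<subseteq> map_prod f f ` parcs G"
  proof
    fix e assume "e \<in> parcs H"
    moreover obtain x y where e: "e = (x,y)" by (cases e)
    ultimately have "x \<in> f ` pverts G" "y \<in> f ` pverts G"
      using V H.wellformed' by auto
    then show "e \<in> map_prod f f ` parcs G"
      using f(2) \<open>e \<in> parcs H\<close> e by force
  qed
  moreover have "(f u, f v) \<in> parcs H" if "(u,v) \<in> parcs G" for u v
    using f(2) G.in_arcsD1[OF that] G.in_arcsD2[OF that] that by blast
  then have "map_prod f f ` parcs G \<subseteq> parcs H"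
    by auto
  ultimately have "with_proj H = app_iso ?h (with_proj G)"
    using V by (auto simp: with_proj_def app_iso_def)
  then show ?L
    using iso by (auto simp: digraph_iso_def)
qed

end

theory Submission
  imports Defs "HOL-Number_Theory.Cong"
begin

text \<open>
  A longest cycle is Hamiltonian: if a vertex \<open>x\<close> off the cycle is adjacent to \<open>c\<close>, then
  claw-freeness makes the two cycle neighbours of \<open>c\<close> adjacent, and a path from \<open>x\<close> back to the
  cycle that avoids \<open>c\<close> yields a longer cycle or a \<open>K\<^sub>4\<close> minor. Two crossing chords of the
  Hamiltonian cycle also yield a \<open>K\<^sub>4\<close> minor, so the chords do not cross, and placing the vertices
  in convex position shows that the graph is outerplanar.

  If some inner face has at least four sides, or three sides none of which lies on the Hamiltonian
  cycle, then claw-freeness allows at most one vertex behind each side, and the graph is in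
  \<open>\<S>\<^sub>t\<close>. Otherwise the chords triangulate the cycle and every triangle has a side on it. Starting
  from a vertex of degree two, claw-freeness then forces the next chord at each step, and the
  chords zigzag as in \<open>\<Z>\<^sub>d\<close> or \<open>\<Z>\<^sup>*\<^sub>d\<close>.
\<close>

section \<open>Walks, minors and induced stars\<close>

lemma vwalk_conv_successively:
  "vwalk xs G \<longleftrightarrow> xs \<noteq> [] \<and> set xs \<subseteq> verts G \<and> successively (\<lambda>u v. u \<rightarrow>\<^bsub>G\<^esub> v) xs"
proof -
  have "set (vwalk_arcs xs) \<subseteq> arcs_ends G \<longleftrightarrow> successively (\<lambda>u v. u \<rightarrow>\<^bsub>G\<^esub> v) xs"
    by (induction xs rule: vwalk_arcs.induct) auto
  then show ?thesis by (auto simp: vwalk_def)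
qed

lemma vwalk_append_iff:
  assumes "xs \<noteq> []" "ys \<noteq> []"
  shows "vwalk (xs @ ys) G \<longleftrightarrow> vwalk xs G \<and> vwalk ys G \<and> last xs \<rightarrow>\<^bsub>G\<^esub> hd ys"
  using assms by (auto simp: vwalk_conv_successively successively_append_iff)

lemma (in wf_digraph) vwalk_induce_subgraph_iff:
  assumes "S \<subseteq> verts G"
  shows "vwalk xs (G \<restriction> S) \<longleftrightarrow> vwalk xs G \<and> set xs \<subseteq> S"
proof -
  have "arcs_ends (G \<restriction> S) = arcs_ends G \<inter> S \<times> S"
    by (auto simp: arcs_ends_conv)
  moreover have "set (vwalk_arcs xs) \<subseteq> set xs \<times> set xs"
    by (auto elim: in_set_vwalk_arcsE)
  ultimately show ?thesis
    using assms by (auto simp: vwalk_def)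
qed

context sym_digraph
begin

lemma connected_iff_strongly_connected:
  "Digraph_Component.connected G \<longleftrightarrow> strongly_connected G"
  using symmetric_connected_imp_strongly_connected[OF sym_arcs]
  by (auto simp: strongly_connected_def intro!: connectedI reachable_mk_symmetricI)

lemma sym_digraph_induce_subgraph:
  "S \<subseteq> verts G \<Longrightarrow> sym_digraph (G \<restriction> S)"
  using induced_induce by (rule induced_graph_imp_graph)

lemma connected_induce_vwalk:
  assumes "vwalk xs G"
  shows "Digraph_Component.connected (G \<restriction> set xs)"
proof -
  have sub: "set xs \<subseteq> verts G" and "xs \<noteq> []"
    using assms by auto
  interpret S: sym_digraph "G \<restriction> set xs"
    by (rule sym_digraph_induce_subgraph[OF sub])
  have walk: "vwalk xs (G \<restriction> set xs)"
    using assms by (simp add: vwalk_induce_subgraph_iff[OF sub])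
  have from_hd: "hd xs \<rightarrow>\<^sup>*\<^bsub>G \<restriction> set xs\<^esub> u" if u: "u \<in> set xs" for u
  proof -
    obtain ys zs where xs: "xs = (ys @ [u]) @ zs"
      using split_list[OF u] by auto
    then have "vwalk (ys @ [u]) (G \<restriction> set xs)"
      using vwalkI_append_l[of "ys @ [u]" zs] walk by simp
    moreover have "hd (ys @ [u]) = hd xs"
      by (simp add: xs hd_append)
    ultimately show ?thesis
      unfolding S.reachable_vwalk_conv by (intro exI[of _ "ys @ [u]"]) simp
  qed
  have "u \<rightarrow>\<^sup>*\<^bsub>G \<restriction> set xs\<^esub> v" if "u \<in> set xs" "v \<in> set xs" for u v
    using symmetric_reachable[OF S.sym_arcs from_hd[OF that(1)]] from_hd[OF that(2)]
    by (rule S.reachable_trans)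
  then show ?thesis
    unfolding S.connected_iff_strongly_connected using \<open>xs \<noteq> []\<close> by auto
qed

lemma k_connected_vpath_avoiding:
  assumes "k_connected k G" "X \<subseteq> verts G" "card X < k" "x \<in> verts G - X" "y \<in> verts G - X"
  obtains xs where "vpath xs G" "hd xs = x" "last xs = y" "set xs \<inter> X = {}"
proof -
  let ?H = "G \<restriction> (verts G - X)"
  interpret H: sym_digraph ?H
    by (rule sym_digraph_induce_subgraph) simp
  have "Digraph_Component.connected ?H"
    using assms(1-3) by (simp add: k_connected_def)
  then have "x \<rightarrow>\<^sup>*\<^bsub>?H\<^esub> y"
    unfolding H.connected_iff_strongly_connected using assms(4,5) by auto
  then obtain xs where "vpath xs ?H" "hd xs = x" "last xs = y"
    unfolding H.reachable_vpath_conv by blast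
  then show thesis
    using that by (auto simp: vpath_def vwalk_induce_subgraph_iff)
qed

lemma minor_complete_graphI:
  assumes branch: "\<And>B. B \<in> set Bs \<Longrightarrow> B \<subseteq> verts G \<and> Digraph_Component.connected (G \<restriction> B)"
    and pairs: "sorted_wrt (\<lambda>A B. A \<inter> B = {} \<and> (\<exists>u\<in>A. \<exists>v\<in>B. u \<rightarrow>\<^bsub>G\<^esub> v)) Bs"
  shows "minor (with_proj (complete_graph (length Bs))) G"
proof -
  have pair: "Bs ! x \<inter> Bs ! y = {} \<and> (\<exists>u\<in>Bs ! x. \<exists>v\<in>Bs ! y. u \<rightarrow>\<^bsub>G\<^esub> v)"
    if "x < length Bs" "y < length Bs" "x \<noteq> y" for x y
  proof (cases "x < y")
    case True
    then show ?thesis using sorted_wrt_nth_less[OF pairs] that by simp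
  next
    case False
    then have "Bs ! y \<inter> Bs ! x = {} \<and> (\<exists>u\<in>Bs ! y. \<exists>v\<in>Bs ! x. u \<rightarrow>\<^bsub>G\<^esub> v)"
      using sorted_wrt_nth_less[OF pairs, of y x] that by simp
    then show ?thesis using arcs_ends_symmetric[OF sym_arcs] by blast
  qed
  show ?thesis
    unfolding minor_def
    by (intro exI[of _ "(!) Bs"]) (use branch pair in \<open>auto simp: complete_graph_def\<close>)
qed

end

definition pair_induce :: "'a pair_pre_digraph \<Rightarrow> 'a set \<Rightarrow> 'a pair_pre_digraph" where
  "pair_induce G S = \<lparr>pverts = S, parcs = parcs G \<inter> S \<times> S\<rparr>"

lemma pair_induce_simps [simp]:
  "pverts (pair_induce G S) = S"
  "parcs (pair_induce G S) = parcs G \<inter> S \<times> S"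
  by (simp_all add: pair_induce_def)

lemma with_proj_pair_induce: "with_proj (pair_induce G S) = with_proj G \<restriction> S"
  by (auto simp: pair_induce_def with_proj_def induce_subgraph_def)

lemma (in pair_graph) pair_graph_pair_induce:
  assumes "S \<subseteq> pverts G"
  shows "pair_graph (pair_induce G S)"
proof
  show "symmetric (with_proj (pair_induce G S))"
    using arcs_symmetric by (auto simp: symmetric_def sym_def)
qed (use finite_subset[OF assms finite_verts] finite_arcs in \<open>auto dest: no_loops'\<close>)

lemma digraph_iso_pairI:
  assumes G: "pair_graph G" and H: "pair_graph H"
    and f: "bij_betw f (pverts H) (pverts G)"
    and arcs: "\<And>x y. x \<in> pverts H \<Longrightarrow> y \<in> pverts H \<Longrightarrow> (x, y) \<in> parcs H \<longleftrightarrow> (f x, f y) \<in> parcs G"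
  shows "digraph_iso (with_proj G) (with_proj H)"
proof -
  interpret H: pair_graph H by fact
  have "digraph_iso (with_proj H) (with_proj G)"
    unfolding digraph_iso_pair_iff[OF H G] using f arcs by blast
  then show ?thesis
    by (rule digraph_iso_swap[OF H.wf_digraph])
qed

lemma digraph_iso_pair_linorderI:
  fixes f :: "'b::linorder \<Rightarrow> 'a"
  assumes G: "pair_graph G" and H: "pair_graph H"
    and f: "bij_betw f (pverts H) (pverts G)"
    and arcs: "\<And>x y. x \<in> pverts H \<Longrightarrow> y \<in> pverts H \<Longrightarrow> x < y \<Longrightarrow>
      (x, y) \<in> parcs H \<longleftrightarrow> (f x, f y) \<in> parcs G"
  shows "digraph_iso (with_proj G) (with_proj H)"
proof (rule digraph_iso_pairI[OF G H f])
  interpret G: pair_graph G by fact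
  interpret H: pair_graph H by fact
  fix x y assume xy: "x \<in> pverts H" "y \<in> pverts H"
  show "(x, y) \<in> parcs H \<longleftrightarrow> (f x, f y) \<in> parcs G"
  proof (cases x y rule: linorder_cases)
    case less
    then show ?thesis using arcs xy by blast
  next
    case equal
    then show ?thesis using G.no_loops' H.no_loops' by blast
  next
    case greater
    then have "(y, x) \<in> parcs H \<longleftrightarrow> (f y, f x) \<in> parcs G" using arcs xy by blast
    then show ?thesis using G.arcs_symmetric H.arcs_symmetric by blast
  qed
qed

abbreviation (in pair_pre_digraph) adj :: "'a \<Rightarrow> 'a \<Rightarrow> bool" where
  "adj u v \<equiv> (u, v) \<in> parcs G"

context pair_graph
begin

lemma adj_commute: "adj u v \<longleftrightarrow> adj v u"
  using arcs_symmetric by blast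

lemma induced_star_freeD:
  assumes free: "induced_free (with_proj (complete_bipartite_graph 1 k)) (with_proj G)"
    and xs: "distinct xs" "length xs = k" "\<And>x. x \<in> set xs \<Longrightarrow> adj a x" and a: "a \<in> pverts G"
  shows "\<exists>x\<in>set xs. \<exists>y\<in>set xs. adj x y"
proof (rule ccontr)
  assume indep: "\<not> ?thesis"
  let ?K = "complete_bipartite_graph (Suc 0) k" and ?H = "pair_induce G (set (a # xs))"
  have sub: "set (a # xs) \<subseteq> pverts G"
    using a wellformed'(2)[OF xs(3)] by auto
  have verts_K: "pverts ?K = {..<length (a # xs)}"
    by (simp add: complete_bipartite_graph_def xs(2))
  have "digraph_iso (with_proj ?H) (with_proj ?K)"
  proof (rule digraph_iso_pair_linorderI)
    show "pair_graph ?H"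
      using sub by (rule pair_graph_pair_induce)
    show "pair_graph ?K"
      using complete_bipartite_graph_K by (rule pair_graphI_complete_bipartite)
    have "distinct (a # xs)"
      using xs no_loops' by auto
    then show "bij_betw ((!) (a # xs)) (pverts ?K) (pverts ?H)"
      by (rule bij_betw_nth) (simp_all add: verts_K)
    fix i j assume "i \<in> pverts ?K" "j \<in> pverts ?K" "i < j"
    then obtain j' where j: "j = Suc j'" "j' < k" "i \<le> j'"
      by (cases j) (auto simp: verts_K xs(2))
    then have "(i, j) \<in> parcs ?K \<longleftrightarrow> i = 0"
      by (auto simp: complete_bipartite_graph_def symcl_def)
    also have "\<dots> \<longleftrightarrow> ((a # xs) ! i, (a # xs) ! j) \<in> parcs ?H"
      using xs indep j by (cases i) auto
    finally show "(i, j) \<in> parcs ?K \<longleftrightarrow> ((a # xs) ! i, (a # xs) ! j) \<in> parcs ?H" .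
  qed
  moreover have "induced_subgraph (with_proj ?H) (with_proj G)"
    unfolding with_proj_pair_induce using sub by (rule induced_induce)
  ultimately show False
    using free by (auto simp: induced_free_def)
qed

end

section \<open>Longest cycles\<close>

definition vcycle :: "'a vwalk \<Rightarrow> ('a, 'b) pre_digraph \<Rightarrow> bool" where
  "vcycle cs G \<longleftrightarrow> 3 \<le> length cs \<and> vpath cs G \<and> last cs \<rightarrow>\<^bsub>G\<^esub> hd cs"

definition longest_vcycle :: "'a vwalk \<Rightarrow> ('a, 'b) pre_digraph \<Rightarrow> bool" where
  "longest_vcycle cs G \<longleftrightarrow> vcycle cs G \<and> (\<forall>ds. vcycle ds G \<longrightarrow> length ds \<le> length cs)"

lemma longest_vcycle_permute:
  "\<lbrakk>longest_vcycle cs G; vcycle ds G; length ds = length cs\<rbrakk> \<Longrightarrow> longest_vcycle ds G"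
  by (simp add: longest_vcycle_def)

context wf_digraph
begin

lemma vcycle_rotate:
  assumes "vcycle (xs @ ys) G"
  shows "vcycle (ys @ xs) G"
proof (cases "xs = [] \<or> ys = []")
  case True
  then show ?thesis using assms by auto
next
  case False
  then show ?thesis
    using assms by (auto simp: vcycle_def vpath_def vwalk_append_iff)
qed

lemma vcycle_start_at:
  assumes "vcycle cs G" "x \<in> set cs"
  obtains ds where "vcycle (x # ds) G" "set (x # ds) = set cs" "length (x # ds) = length cs"
proof -
  obtain us vs where "cs = us @ x # vs" using split_list[OF assms(2)] by blast
  then show thesis
    using that[of "vs @ us"] vcycle_rotate[of us "x # vs"] assms(1) by auto
qed

lemma vcycle_nth_succ:
  assumes cs: "vcycle cs G" and k: "k < length cs"
  shows "cs ! k \<rightarrow>\<^bsub>G\<^esub> cs ! (Suc k mod length cs)"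
proof (cases "Suc k = length cs")
  case True
  then have "k = length cs - 1" "cs \<noteq> []" by auto
  then show ?thesis
    using cs True by (simp add: vcycle_def last_conv_nth hd_conv_nth)
next
  case False
  have "successively (\<lambda>u v. u \<rightarrow>\<^bsub>G\<^esub> v) cs"
    using cs by (simp add: vcycle_def vpath_def vwalk_conv_successively)
  then show ?thesis
    using successively_nth[of _ cs k] False k by simp
qed

lemma vcycle_detour:
  assumes cyc: "vcycle (c # ds) G" and P: "vpath P G" "set P \<inter> set (c # ds) = {}"
    and "c \<rightarrow>\<^bsub>G\<^esub> hd P" "last P \<rightarrow>\<^bsub>G\<^esub> hd ds"
  shows "vcycle (c # P @ ds) G"
proof -
  have "P \<noteq> []" "ds \<noteq> []" using P cyc by (auto simp: vpath_def vcycle_def)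
  then show ?thesis
    using assms vwalk_append_iff[of "[c]" "P @ ds"] vwalk_append_iff[of "[c]" ds]
      vwalk_append_iff[of P ds]
    by (auto simp: vcycle_def vpath_def)
qed

lemma vpath_first_entryE:
  assumes xs: "vpath xs G" "hd xs \<notin> S" "last xs \<in> S"
  obtains ys z where "vpath ys G" "hd ys = hd xs" "set ys \<subseteq> set xs - S" "z \<in> S" "last ys \<rightarrow>\<^bsub>G\<^esub> z"
proof -
  have "xs \<noteq> []" using xs(1) by (auto simp: vpath_def)
  then have "\<exists>z\<in>set xs. z \<in> S" using xs(3) last_in_set by blast
  then obtain ys z zs where split: "xs = ys @ z # zs" "z \<in> S" "\<forall>y\<in>set ys. y \<notin> S"
    by (rule split_list_first_propE)
  then have "ys \<noteq> []" using xs(2) by auto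
  with split xs(1) have "vpath ys G" "last ys \<rightarrow>\<^bsub>G\<^esub> z"
    by (auto simp: vpath_def vwalk_append_iff)
  with split \<open>ys \<noteq> []\<close> show thesis
    by (intro that[of ys z]) auto
qed

lemma longest_vcycle_no_detour:
  assumes "longest_vcycle (c # ds) G" "vpath P G" "set P \<inter> set (c # ds) = {}" "c \<rightarrow>\<^bsub>G\<^esub> hd P"
  shows "\<not> last P \<rightarrow>\<^bsub>G\<^esub> hd ds"
proof
  assume "last P \<rightarrow>\<^bsub>G\<^esub> hd ds"
  then have "vcycle (c # P @ ds) G"
    using assms by (intro vcycle_detour) (auto simp: longest_vcycle_def)
  then have "length (c # P @ ds) \<le> length (c # ds)"
    using assms(1) by (auto simp: longest_vcycle_def)
  moreover have "P \<noteq> []" using assms(2) by (auto simp: vpath_def)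
  ultimately show False by simp
qed

end

context sym_digraph
begin

lemma vcycle_rev: "vcycle cs G \<Longrightarrow> vcycle (rev cs) G"
  using vwalk_rev_ex[OF sym_arcs] arcs_ends_symmetric[OF sym_arcs]
  by (auto simp: vcycle_def vpath_def hd_rev last_rev)

lemma longest_vcycle_Cons_rev:
  assumes "longest_vcycle (c # ds) G"
  shows "longest_vcycle (c # rev ds) G"
proof -
  have "vcycle (rev (c # ds)) G"
    using assms vcycle_rev unfolding longest_vcycle_def by blast
  then have "vcycle (c # rev ds) G"
    using vcycle_rotate[of "rev ds" "[c]"] by simp
  then show ?thesis using longest_vcycle_permute[OF assms] by simp
qed

lemma cycle_crossing_walks_imp_K4_minor:
  assumes cyc: "vcycle (A @ B @ C @ D) G" and ne: "A \<noteq> []" "B \<noteq> []" "C \<noteq> []" "D \<noteq> []"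
    and A': "vwalk A' G" "set A \<subseteq> set A'" "set A' \<inter> set (B @ C @ D) = {}"
    and chords: "\<exists>u\<in>set A'. \<exists>v\<in>set C. u \<rightarrow>\<^bsub>G\<^esub> v" "\<exists>u\<in>set B. \<exists>v\<in>set D. u \<rightarrow>\<^bsub>G\<^esub> v"
  shows "minor (with_proj (complete_graph 4)) G"
proof -
  have walks: "vwalk B G" "vwalk C G" "vwalk D G" and dist: "distinct (B @ C @ D)"
    and succ: "last A \<rightarrow>\<^bsub>G\<^esub> hd B" "last B \<rightarrow>\<^bsub>G\<^esub> hd C" "last C \<rightarrow>\<^bsub>G\<^esub> hd D" "hd A \<rightarrow>\<^bsub>G\<^esub> last D"
    using cyc ne arcs_ends_symmetric[OF sym_arcs]
    by (auto simp: vcycle_def vpath_def vwalk_append_iff)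
  have sides: "\<exists>u\<in>set A'. \<exists>v\<in>set B. u \<rightarrow>\<^bsub>G\<^esub> v" "\<exists>u\<in>set B. \<exists>v\<in>set C. u \<rightarrow>\<^bsub>G\<^esub> v"
      "\<exists>u\<in>set C. \<exists>v\<in>set D. u \<rightarrow>\<^bsub>G\<^esub> v" "\<exists>u\<in>set A'. \<exists>v\<in>set D. u \<rightarrow>\<^bsub>G\<^esub> v"
    using succ ne A'(2) by (meson hd_in_set last_in_set subsetD)+
  have "minor (with_proj (complete_graph (length (map set [A', B, C, D])))) G"
  proof (rule minor_complete_graphI)
    fix S assume "S \<in> set (map set [A', B, C, D])"
    then show "S \<subseteq> verts G \<and> Digraph_Component.connected (G \<restriction> S)"
      using A'(1) walks connected_induce_vwalk by auto
  next
    have "set A' \<inter> set B = {}" "set A' \<inter> set C = {}" "set A' \<inter> set D = {}"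
      "set B \<inter> set C = {}" "set B \<inter> set D = {}" "set C \<inter> set D = {}"
      using A'(3) dist by auto
    then show "sorted_wrt (\<lambda>A B. A \<inter> B = {} \<and> (\<exists>u\<in>A. \<exists>v\<in>B. u \<rightarrow>\<^bsub>G\<^esub> v)) (map set [A', B, C, D])"
      using sides chords by simp
  qed
  then show ?thesis by (simp add: eval_nat_numeral)
qed

end

locale two_connected_graph = pair_graph +
  assumes two_connected: "k_connected 2 (with_proj G)"
begin

lemma vpath_avoiding:
  assumes "z \<in> pverts G" "x \<in> pverts G - {z}" "y \<in> pverts G - {z}"
  obtains xs where "vpath xs G" "hd xs = x" "last xs = y" "z \<notin> set xs"
  by (rule k_connected_vpath_avoiding[OF two_connected, of "{z}" x y]) (use assms in auto)

lemma vpath_to_set_avoidingE: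
  assumes "z \<in> pverts G" "x \<in> pverts G - {z}" "x \<notin> S" "S \<subseteq> pverts G - {z}" "S \<noteq> {}"
  obtains P y where "vpath P G" "hd P = x" "set P \<inter> insert z S = {}" "y \<in> S" "adj (last P) y"
proof -
  obtain y where y: "y \<in> S" using assms(5) by blast
  then obtain xs where xs: "vpath xs G" "hd xs = x" "last xs = y" "z \<notin> set xs"
    using vpath_avoiding[OF assms(1,2), of y] assms(4) by blast
  show thesis
    by (rule vpath_first_entryE[of xs S]) (use that xs y assms(3) in auto)
qed

lemma ex_third_vertex: "\<exists>z\<in>pverts G. z \<noteq> x \<and> z \<noteq> y"
proof -
  have "card {x, y} < card (pverts G)"
    using two_connected card_insert_le_m1[of 2 "{y}" x] by (simp add: k_connected_def)
  then have "\<not> pverts G \<subseteq> {x, y}"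
    using card_mono[of "{x, y}" "pverts G"] by auto
  then show ?thesis by blast
qed

lemma ex_neighbour_avoiding:
  assumes "u \<in> pverts G" "v \<in> pverts G" "u \<noteq> v"
  shows "\<exists>w. adj u w \<and> w \<noteq> v"
proof -
  obtain z where z: "z \<in> pverts G" "z \<noteq> u" "z \<noteq> v" using ex_third_vertex by blast
  then obtain xs where xs: "vpath xs G" "hd xs = u" "last xs = z" "v \<notin> set xs"
    using vpath_avoiding[of v u z] assms by auto
  then obtain w ys where "xs = u # w # ys"
    using z(2) by (cases xs; cases "tl xs") (auto simp: vpath_def)
  then show ?thesis using xs by (auto simp: vpath_def)
qed

lemma vcycle_exists: "\<exists>cs. vcycle cs G"
proof -
  obtain u u' where u: "u \<in> pverts G" and u': "u' \<in> pverts G" "u \<noteq> u'"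
    using ex_third_vertex by metis
  obtain v where v: "adj u v" using ex_neighbour_avoiding[OF u u'] by blast
  then obtain w where w: "adj u w" "w \<noteq> v"
    using ex_neighbour_avoiding[OF u, of v] wellformed' no_loops' by blast
  obtain xs where xs: "vpath xs G" "hd xs = v" "last xs = w" "u \<notin> set xs"
    using vpath_avoiding[of u v w] u v w(1) wellformed' no_loops' by blast
  then obtain y ys where "xs = v # y # ys"
    using w(2) by (cases xs; cases "tl xs") (auto simp: vpath_def)
  then have "vcycle (u # xs) G"
    using xs v w(1) arcs_symmetric by (auto simp: vcycle_def vpath_def)
  then show ?thesis by blast
qed

lemma longest_vcycle_exists: "\<exists>cs. longest_vcycle cs G"
proof -
  have "length cs < Suc (card (pverts G))" if "vcycle cs G" for cs
    using that card_mono[OF finite_verts, of "set cs"]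
    by (auto simp: vcycle_def vpath_def distinct_card vwalk_def)
  then show ?thesis
    using vcycle_exists ex_has_greatest_nat[of "\<lambda>cs. vcycle cs G" _ length "Suc (card (pverts G))"]
    unfolding longest_vcycle_def by blast
qed

lemma ex_edge_leaving_vcycle:
  assumes cs: "vcycle cs G" and "set cs \<noteq> pverts G"
  shows "\<exists>c\<in>set cs. \<exists>x. x \<notin> set cs \<and> adj c x"
proof -
  have sub: "set cs \<subseteq> pverts G" using cs by (auto simp: vcycle_def vpath_def vwalk_def)
  then obtain y where y: "y \<in> pverts G" "y \<notin> set cs" using assms(2) by auto
  obtain c c' cs' where "cs = c # c' # cs'"
    using cs by (cases cs; cases "tl cs") (auto simp: vcycle_def)
  moreover from this cs have "c \<noteq> c'" by (simp add: vcycle_def vpath_def)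
  ultimately obtain xs where xs: "vpath xs G" "hd xs = c" "last xs = y" "c \<in> set cs"
    using vpath_avoiding[of c' c y] sub y by auto
  obtain ys z where "vpath ys G" "set ys \<subseteq> set xs - - set cs" "z \<in> - set cs" "adj (last ys) z"
    by (rule vpath_first_entryE[of xs "- set cs"]) (use xs y in auto)
  moreover from this have "last ys \<in> set cs"
    using last_in_set[of ys] by (auto simp: vpath_def vwalk_def)
  ultimately show ?thesis by auto
qed

end

locale claw_free_graph = pair_graph +
  assumes claw_free: "induced_free (with_proj (complete_bipartite_graph 1 3)) (with_proj G)"
begin

lemma claw:
  assumes "adj a x" "adj a y" "adj a z" "x \<noteq> y" "y \<noteq> z" "x \<noteq> z"
  shows "adj x y \<or> adj y z \<or> adj x z"
proof -
  have "\<exists>u\<in>set [x, y, z]. \<exists>v\<in>set [x, y, z]. adj u v"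
    using assms wellformed' by (intro induced_star_freeD[OF claw_free, of _ a]) auto
  then show ?thesis
    using no_loops' arcs_symmetric by auto
qed

lemma longest_vcycle_chord:
  assumes longest: "longest_vcycle (c # ds) G" and x: "adj c x" "x \<notin> set (c # ds)"
  shows "adj (hd ds) (last ds)"
proof -
  have ds: "ds \<noteq> []" "hd ds \<noteq> last ds" and nbrs: "adj c (hd ds)" "adj c (last ds)"
    using longest arcs_symmetric
    by (cases ds; auto simp: longest_vcycle_def vcycle_def vpath_def)+
  have "vpath [x] G" using x wellformed' by (auto simp: vpath_def)
  then have "\<not> adj x (hd ds)" "\<not> adj x (last ds)"
    using longest_vcycle_no_detour[OF longest, of "[x]"] x
      longest_vcycle_no_detour[OF longest_vcycle_Cons_rev[OF longest], of "[x]"] ds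
    by (auto simp: hd_rev)
  moreover have "x \<noteq> hd ds" "x \<noteq> last ds" using x(2) ds(1) by auto
  ultimately show ?thesis
    using claw[OF nbrs x(1)] ds(2) adj_commute by metis
qed

lemma longest_vcycle_ear_imp_K4_minor:
  assumes longest: "longest_vcycle (c # ds) G"
    and P: "vpath P G" "set P \<inter> set (c # ds) = {}" "adj c (hd P)"
    and r: "r \<in> set ds" "adj (last P) r"
  shows "minor (with_proj (complete_graph 4)) (with_proj G)"
proof -
  have cyc: "vcycle (c # ds) G" and "P \<noteq> []"
    using longest P(1) by (auto simp: longest_vcycle_def vpath_def)
  then have chord: "adj (hd ds) (last ds)"
    using longest_vcycle_chord[OF longest P(3)] P(2) hd_in_set by blast
  obtain us ws where split: "ds = us @ r # ws" using split_list[OF r(1)] by blast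
  have "us \<noteq> []"
    using longest_vcycle_no_detour[OF longest P] r(2) split by auto
  have "ws \<noteq> []"
    using longest_vcycle_no_detour[OF longest_vcycle_Cons_rev[OF longest] P(1) _ P(3)] P(2) r(2)
      split by auto
  show ?thesis
  proof (rule cycle_crossing_walks_imp_K4_minor[of "[c]" us "[r]" ws "c # P"])
    show "vcycle ([c] @ us @ [r] @ ws) G" using cyc split by simp
    show "vwalk (c # P) G"
      using P(1,3) \<open>P \<noteq> []\<close> wellformed'(1)[OF P(3)] vwalk_append_iff[of "[c]" P "with_proj G"]
      by (simp add: vpath_def)
    show "set (c # P) \<inter> set (us @ [r] @ ws) = {}"
      using P(2) cyc split by (auto simp: vcycle_def vpath_def)
    show "\<exists>u\<in>set (c # P). \<exists>v\<in>set [r]. adj u v"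
      using r(2) \<open>P \<noteq> []\<close> by auto
    show "\<exists>u\<in>set us. \<exists>v\<in>set ws. adj u v"
      using chord split \<open>us \<noteq> []\<close> \<open>ws \<noteq> []\<close>
      by (intro bexI[of _ "hd us"] bexI[of _ "last ws"]) auto
  qed (use \<open>us \<noteq> []\<close> \<open>ws \<noteq> []\<close> in auto)
qed

end

locale two_connected_claw_K4_free_graph = two_connected_graph + claw_free_graph +
  assumes K4_minor_free: "minor_free (with_proj (complete_graph 4)) (with_proj G)"
begin

lemma longest_vcycle_spans:
  assumes longest: "longest_vcycle cs G"
  shows "set cs = pverts G"
proof (rule ccontr)
  assume "set cs \<noteq> pverts G"
  then obtain c x where c: "c \<in> set cs" and x: "x \<notin> set cs" "adj c x"
    using ex_edge_leaving_vcycle longest unfolding longest_vcycle_def by blast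
  obtain ds where ds: "vcycle (c # ds) G" "set (c # ds) = set cs" "length (c # ds) = length cs"
    using longest c by (auto simp: longest_vcycle_def elim: vcycle_start_at)
  have "set ds \<noteq> {}" "c \<notin> set ds" "set ds \<subseteq> pverts G - {c}"
    using ds(1) by (auto simp: vcycle_def vpath_def vwalk_def)
  moreover have "c \<in> pverts G" "x \<in> pverts G - {c}" "x \<notin> set ds"
    using wellformed'[OF x(2)] no_loops'[OF x(2)] x(1) ds(2) by auto
  ultimately obtain P r where "vpath P G" "hd P = x" "set P \<inter> set (c # ds) = {}"
      "r \<in> set ds" "adj (last P) r"
    using vpath_to_set_avoidingE[of c x "set ds"] by auto
  then have "minor (with_proj (complete_graph 4)) (with_proj G)"
    using longest_vcycle_permute[OF longest ds(1,3)] x(2)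
    by (intro longest_vcycle_ear_imp_K4_minor) auto
  then show False using K4_minor_free by (simp add: minor_free_def)
qed

end

section \<open>Labellings of the Hamiltonian cycle\<close>

text \<open>
  The vertices of a Hamiltonian cycle are labelled by all integers, with period \<open>n\<close>. Rotations and
  reflections of the cycle then are translations and reflections of the integers, and indices need
  no reduction modulo \<open>n\<close>.
\<close>

locale cyclic_labelling = pair_graph G for G :: "'a pair_pre_digraph" +
  fixes c :: "int \<Rightarrow> 'a" and n :: int
  assumes three_le: "3 \<le> n"
    and label_eq_iff: "c i = c j \<longleftrightarrow> [i = j] (mod n)"
    and range_label: "range c = pverts G"
    and adj_succ: "adj (c i) (c (i + 1))"
begin

abbreviation label_adj :: "int \<Rightarrow> int \<Rightarrow> bool" (infix "\<frown>" 50) where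
  "i \<frown> j \<equiv> adj (c i) (c j)"

lemma label_adj_commute: "i \<frown> j \<longleftrightarrow> j \<frown> i"
  by (rule adj_commute)

lemma adj_pred: "i \<frown> i - 1"
  using adj_succ[of "i - 1"] label_adj_commute by simp

lemma label_add_period: "c (i + n) = c i"
  by (simp add: label_eq_iff cong_iff_dvd_diff)

lemma label_add_periods: "c (i + n * m) = c i"
  by (simp add: label_eq_iff cong_iff_dvd_diff)

lemma closing_edge: "m \<frown> m + n - 1"
  using adj_pred[of "m + n"] label_add_period[of m] by simp

lemma label_neq:
  assumes "i < j" "j < i + n"
  shows "c i \<noteq> c j"
  using assms zdvd_imp_le[of n "j - i"]
  by (auto simp: label_eq_iff cong_iff_dvd_diff dvd_diff_commute)

lemma inj_on_window: "inj_on c {m..<m + n}"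
  by (rule linorder_inj_onI) (use label_neq in force)+

lemma bij_betw_window: "bij_betw c {m..<m + n} (pverts G)"
proof (rule bij_betw_imageI[OF inj_on_window])
  have "c i \<in> c ` {m..<m + n}" for i
  proof (rule image_eqI)
    show "c i = c (m + (i - m) mod n)"
      by (simp add: label_eq_iff cong_def mod_simps)
    show "m + (i - m) mod n \<in> {m..<m + n}"
      using three_le by simp
  qed
  then show "c ` {m..<m + n} = pverts G"
    unfolding range_label[symmetric] by auto
qed

lemma cyclic_labelling_shift: "cyclic_labelling G (\<lambda>i. c (i + m)) n"
proof
  show "range (\<lambda>i. c (i + m)) = pverts G"
    unfolding range_label[symmetric] by (auto simp: image_iff) (metis diff_add_cancel)
  show "adj (c (i + m)) (c (i + 1 + m))" for i
    using adj_succ[of "i + m"] by (simp add: ac_simps)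
qed (use three_le in \<open>auto simp: label_eq_iff cong_add_rcancel\<close>)

lemma cyclic_labelling_reflect: "cyclic_labelling G (\<lambda>i. c (m - i)) n"
proof
  show "range (\<lambda>i. c (m - i)) = pverts G"
    unfolding range_label[symmetric]
    by (auto simp: image_iff) (metis diff_diff_eq2 add_diff_cancel_left')
  show "adj (c (m - i)) (c (m - (i + 1)))" for i
    using adj_pred[of "m - i"] by (simp add: algebra_simps)
  show "c (m - i) = c (m - j) \<longleftrightarrow> [i = j] (mod n)" for i j
    by (simp add: label_eq_iff cong_iff_dvd_diff dvd_diff_commute)
qed (rule three_le)

lemma vwalk_labels:
  assumes "i < j"
  shows "vwalk (map c [i..j - 1]) G"
proof -
  have "successively adj (map c [i..j - 1])"
    using adj_succ[of "i + int k" for k] by (auto simp: successively_conv_nth ac_simps)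
  then show ?thesis
    using assms range_label by (auto simp: vwalk_conv_successively)
qed

lemma vcycle_labels: "vcycle (map c [m..m + n - 1]) G"
proof -
  have "distinct (map c [m..m + n - 1])"
    using inj_on_window[of m] by (auto simp: distinct_map elim: inj_on_subset)
  moreover have "m + n - 1 \<frown> m"
    using closing_edge label_adj_commute by blast
  ultimately show ?thesis
    using three_le vwalk_labels[of m "m + n"]
    by (auto simp: vcycle_def vpath_def hd_map last_map hd_conv_nth last_conv_nth add_diff_eq)
qed

lemma crossing_chords_imp_K4_minor:
  assumes "i < j" "j < k" "k < l" "l < i + n" "i \<frown> k" "j \<frown> l"
  shows "minor (with_proj (complete_graph 4)) (with_proj G)"
proof -
  let ?arc = "\<lambda>x y. map c [x..y - 1]"
  have split: "map c [i..i + n - 1] = ?arc i j @ ?arc j k @ ?arc k l @ ?arc l (i + n)"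
    using assms(1-4) upto_split1[of i j "i + n - 1"] upto_split1[of j k "i + n - 1"]
      upto_split1[of k l "i + n - 1"] by simp
  show ?thesis
  proof (rule cycle_crossing_walks_imp_K4_minor[of
        "?arc i j" "?arc j k" "?arc k l" "?arc l (i + n)"])
    show "vcycle (?arc i j @ ?arc j k @ ?arc k l @ ?arc l (i + n)) G"
      using vcycle_labels[of i] unfolding split .
    then show "set (?arc i j) \<inter> set (?arc j k @ ?arc k l @ ?arc l (i + n)) = {}"
      unfolding vcycle_def vpath_def distinct_append by blast
    show "\<exists>u\<in>set (?arc i j). \<exists>v\<in>set (?arc k l). adj u v"
      using assms by (intro bexI[of _ "c i"] bexI[of _ "c k"]) auto
    show "\<exists>u\<in>set (?arc j k). \<exists>v\<in>set (?arc l (i + n)). adj u v"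
      using assms by (intro bexI[of _ "c j"] bexI[of _ "c l"]) auto
  qed (use assms(1-4) vwalk_labels in auto)
qed

end

lemma (in pair_graph) cyclic_labelling_of_vcycle:
  assumes cs: "vcycle cs G" "set cs = pverts G"
  shows "cyclic_labelling G (\<lambda>i. cs ! nat (i mod int (length cs))) (int (length cs))"
proof
  let ?n = "int (length cs)" and ?c = "\<lambda>i. cs ! nat (i mod int (length cs))"
  have len: "3 \<le> length cs" and dist: "distinct cs"
    using cs(1) by (auto simp: vcycle_def vpath_def)
  show "3 \<le> ?n" using len by simp
  have mod: "0 \<le> i mod ?n" "i mod ?n < ?n" for i
    using len by (auto intro!: pos_mod_sign pos_mod_bound)
  then have index: "nat (i mod ?n) < length cs" for i
    by (simp add: nat_less_iff)
  show "?c i = ?c j \<longleftrightarrow> [i = j] (mod ?n)" for i j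
    using mod[of i] mod[of j]
    by (simp add: nth_eq_iff_index_eq[OF dist index index] cong_def eq_nat_nat_iff)
  have "?c (int k) = cs ! k" if "k < length cs" for k
    using that by (simp add: mod_pos_pos_trivial)
  then have "cs ! k \<in> range ?c" if "k < length cs" for k
    using that by (metis rangeI)
  then have "pverts G \<subseteq> range ?c"
    unfolding cs(2)[symmetric] by (auto simp: in_set_conv_nth)
  moreover have "range ?c \<subseteq> pverts G"
    unfolding cs(2)[symmetric] using index by (auto intro: nth_mem)
  ultimately show "range ?c = pverts G" by blast
  have "nat ((i + 1) mod ?n) = Suc (nat (i mod ?n)) mod length cs" for i
  proof -
    have "(i + 1) mod ?n = (i mod ?n + 1) mod ?n" by (simp add: mod_simps)
    also have "\<dots> = int (Suc (nat (i mod ?n)) mod length cs)"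
      using mod by (simp add: zmod_int add.commute)
    finally show ?thesis by simp
  qed
  then show "adj (?c i) (?c (i + 1))" for i
    using vcycle_nth_succ[OF cs(1) index] by simp
qed

locale noncrossing_labelling = cyclic_labelling +
  assumes noncrossing: "\<lbrakk>i < j; j < k; k < l; l < i + n; i \<frown> k; j \<frown> l\<rbrakk> \<Longrightarrow> False"

locale claw_free_noncrossing_labelling = noncrossing_labelling + claw_free_graph
begin

lemma claw_labels:
  assumes "x < y" "y < z" "z < x + n" "a \<frown> x" "a \<frown> y" "a \<frown> z"
  shows "x \<frown> y \<or> y \<frown> z \<or> x \<frown> z"
  using assms by (intro claw[of "c a"] label_neq) auto

lemma labelling_shift: "claw_free_noncrossing_labelling G (\<lambda>i. c (i + m)) n"
proof -
  interpret shift: cyclic_labelling G "\<lambda>i. c (i + m)" n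
    by (rule cyclic_labelling_shift)
  show ?thesis
    by unfold_locales (use noncrossing[of "_ + m" "_ + m" "_ + m" "_ + m"] in simp)
qed

lemma labelling_reflect: "claw_free_noncrossing_labelling G (\<lambda>i. c (m - i)) n"
proof -
  interpret reflect: cyclic_labelling G "\<lambda>i. c (m - i)" n
    by (rule cyclic_labelling_reflect)
  show ?thesis
  proof
    fix i j k l assume "i < j" "j < k" "k < l" "l < i + n" "m - i \<frown> m - k" "m - j \<frown> m - l"
    then show False
      using noncrossing[of "m - l" "m - k" "m - j" "m - i"] label_adj_commute by simp
  qed
qed

end

context two_connected_claw_K4_free_graph
begin

lemma claw_free_noncrossing_labelling_exists: "\<exists>c n. claw_free_noncrossing_labelling G c n"
proof -
  obtain cs where cs: "longest_vcycle cs G"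
    using longest_vcycle_exists by blast
  let ?c = "\<lambda>i. cs ! nat (i mod int (length cs))" and ?n = "int (length cs)"
  interpret cyclic_labelling G ?c ?n
    using cs longest_vcycle_spans[OF cs]
    by (intro cyclic_labelling_of_vcycle) (auto simp: longest_vcycle_def)
  have "claw_free_noncrossing_labelling G ?c ?n"
    by unfold_locales
      (use crossing_chords_imp_K4_minor K4_minor_free in \<open>auto simp: minor_free_def\<close>)
  then show ?thesis by blast
qed

end

section \<open>Zigzags\<close>

locale zigzag_labelling = cyclic_labelling +
  assumes zigzag: "\<lbrakk>0 \<le> i; i < j; j < n\<rbrakk> \<Longrightarrow>
    i \<frown> j \<longleftrightarrow> j = i + 1 \<or> i + j = n - 1 \<or> i + j = n - 2"

context claw_free_noncrossing_labelling
begin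

lemma zigzag_step_left:
  assumes "a - 1 \<frown> b" "a \<frown> b" "a + 1 < b" "b + 1 < a - 1 + n"
  shows "a \<frown> b - 1"
proof -
  have "\<not> a \<frown> b + 1"
    using noncrossing[of "a - 1" a b "b + 1"] assms by auto
  moreover have "\<not> b - 1 \<frown> b + 1"
    using noncrossing[of "a - 1" "b - 1" b "b + 1"] assms by auto
  ultimately show ?thesis
    using claw_labels[of a "b - 1" "b + 1" b] assms adj_pred adj_succ label_adj_commute by auto
qed

lemma zigzag_step_right:
  assumes "a \<frown> b + 1" "a \<frown> b" "a + 1 < b" "b + 1 < a - 1 + n"
  shows "a + 1 \<frown> b"
proof -
  interpret reflect: claw_free_noncrossing_labelling G "\<lambda>i. c (0 - i)" n
    by (rule labelling_reflect)
  show ?thesis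
    using reflect.zigzag_step_left[of "- b" "- a"] assms label_adj_commute
    by (simp add: add.commute)
qed

lemma zigzag_chords:
  assumes start: "0 \<frown> n - 2" "4 \<le> n \<Longrightarrow> 1 \<frown> n - 2" and "0 \<le> m"
  shows "(m < n - 2 - m \<longrightarrow> m \<frown> n - 2 - m) \<and> (m + 1 < n - 2 - m \<longrightarrow> m + 1 \<frown> n - 2 - m)"
  using \<open>0 \<le> m\<close>
proof (induction m rule: int_ge_induct)
  case base
  then show ?case using start by auto
next
  case (step m)
  have left: "m + 1 \<frown> n - 2 - (m + 1)" if "m + 1 < n - 2 - (m + 1)"
    using zigzag_step_left[of "m + 1" "n - 2 - m"] step that by (auto simp: algebra_simps)
  moreover have "m + 1 + 1 \<frown> n - 2 - (m + 1)" if "m + 1 + 1 < n - 2 - (m + 1)"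
    using zigzag_step_right[of "m + 1" "n - 2 - (m + 1)"] left step that
    by (auto simp: algebra_simps)
  ultimately show ?case by blast
qed

lemma zigzag_chord:
  assumes start: "0 \<frown> n - 2" "4 \<le> n \<Longrightarrow> 1 \<frown> n - 2" and "0 \<le> m" "m < n - 2 - m"
  shows "m \<frown> n - 2 - m"
  using zigzag_chords[OF start] assms(3,4) by blast

lemma zigzag_chord_pred:
  assumes start: "0 \<frown> n - 2" "4 \<le> n \<Longrightarrow> 1 \<frown> n - 2" and "0 \<le> m" "m < n - 1 - m"
  shows "m \<frown> n - 1 - m"
proof (cases "m = 0")
  case True
  then show ?thesis using closing_edge[of 0] by simp
next
  case False
  then show ?thesis
    using zigzag_chords[OF start, of "m - 1"] assms(3,4) by (simp add: algebra_simps)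
qed

lemma zigzag_labellingI:
  assumes start: "0 \<frown> n - 2" "4 \<le> n \<Longrightarrow> 1 \<frown> n - 2"
  shows "zigzag_labelling G c n"
proof
  fix i j assume ij: "0 \<le> i" "i < j" "j < n"
  note chord = zigzag_chord[OF start] zigzag_chord_pred[OF start]
  show "i \<frown> j \<longleftrightarrow> j = i + 1 \<or> i + j = n - 1 \<or> i + j = n - 2"
  proof
    assume adj: "i \<frown> j"
    show "j = i + 1 \<or> i + j = n - 1 \<or> i + j = n - 2"
    proof (rule ccontr)
      assume "\<not> ?thesis"
      then consider (low) "i + 1 < j" "i + j \<le> n - 3" | (high) "i + 1 < j" "n \<le> i + j"
        using ij by linarith
      then show False
      proof cases
        case low
        then show ?thesis
          using noncrossing[of i "i + 1" j "n - 2 - i"] chord(2)[of "i + 1"] adj ij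
          by (simp add: algebra_simps)
      next
        case high
        then show ?thesis
          using noncrossing[of "n - 1 - j" i "j - 1" j] chord(1)[of "n - 1 - j"] adj ij by simp
      qed
    qed
  next
    assume "j = i + 1 \<or> i + j = n - 1 \<or> i + j = n - 2"
    then consider "j = i + 1" | "j = n - 1 - i" | "j = n - 2 - i" by linarith
    then show "i \<frown> j"
      by cases (use adj_succ chord ij in auto)
  qed
qed

definition triangulated :: bool where
  "triangulated \<longleftrightarrow>
    (\<forall>i j. i + 2 \<le> j \<longrightarrow> j < i + n \<longrightarrow> i \<frown> j \<longrightarrow> (\<exists>k. i < k \<and> k < j \<and> i \<frown> k \<and> k \<frown> j))"

definition inner_triangle :: "int \<Rightarrow> int \<Rightarrow> int \<Rightarrow> bool" where
  "inner_triangle i k j \<longleftrightarrow>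
    i + 2 \<le> k \<and> k + 2 \<le> j \<and> j + 2 \<le> i + n \<and> i \<frown> k \<and> k \<frown> j \<and> i \<frown> j"

lemma ear_exists:
  assumes tri: triangulated
  shows "\<exists>m. m \<frown> m + 2"
proof -
  have ear_below: "\<exists>m. m \<frown> m + 2" if "i + 2 \<le> j" "j < i + n" "i \<frown> j" for i j
    using that
  proof (induction "nat (j - i)" arbitrary: i j rule: less_induct)
    case less
    show ?case
    proof (cases "j = i + 2")
      case False
      obtain k where k: "i < k" "k < j" "i \<frown> k" "k \<frown> j"
        using tri less.prems unfolding triangulated_def by blast
      then consider "i + 2 \<le> k" | "k + 2 \<le> j" using False less.prems by linarith
      then show ?thesis
        by cases (use less.hyps[of k i] less.hyps[of j k] k less.prems in auto)
    qed (use less.prems in auto)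
  qed
  have "0 \<frown> n - 1"
    using closing_edge[of 0] by simp
  then show ?thesis using ear_below[of 0 "n - 1"] three_le by simp
qed

lemma triangle_behind_ear:
  assumes tri: triangulated and no_inner: "\<And>i k j. \<not> inner_triangle i k j"
    and ear: "m \<frown> m + n - 2" and "4 \<le> n"
  shows "m + 1 \<frown> m + n - 2 \<or> 5 \<le> n \<and> m \<frown> m + n - 3"
proof (cases "n = 4")
  case True
  then show ?thesis using adj_succ[of "m + 1"] by simp
next
  case False
  then obtain k where k: "m < k" "k < m + n - 2" "m \<frown> k" "k \<frown> m + n - 2"
    using tri[unfolded triangulated_def, rule_format, of m "m + n - 2"] ear \<open>4 \<le> n\<close> by auto
  then have "k = m + 1 \<or> k = m + n - 3"
    using no_inner[of m k "m + n - 2"] ear unfolding inner_triangle_def by linarith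
  then show ?thesis using k False \<open>4 \<le> n\<close> by auto
qed

lemma triangulated_imp_zigzag:
  assumes tri: triangulated and "\<And>i k j. \<not> inner_triangle i k j"
  shows "\<exists>b. zigzag_labelling G b n"
proof -
  obtain m' where m': "m' \<frown> m' + 2" using ear_exists[OF tri] by blast
  define m where "m = m' + 2"
  interpret shift: claw_free_noncrossing_labelling G "\<lambda>i. c (i + m)" n
    by (rule labelling_shift)
  interpret reflect: claw_free_noncrossing_labelling G "\<lambda>i. c (m + n - 2 - i)" n
    by (rule labelling_reflect)
  have ear: "m \<frown> m + n - 2"
    using m' label_add_period[of m'] label_adj_commute by (simp add: m_def algebra_simps)
  consider "n = 3 \<or> m + 1 \<frown> m + n - 2" | "5 \<le> n" "m \<frown> m + n - 3"
    using triangle_behind_ear[OF assms ear] three_le by force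
  then show ?thesis
  proof cases
    case 1
    then show ?thesis
      using shift.zigzag_labellingI ear by (auto simp: algebra_simps)
  next
    case 2
    then show ?thesis
      using reflect.zigzag_labellingI ear label_adj_commute by (auto simp: algebra_simps)
  qed
qed

end

lemma pverts_graph_Z: "pverts (graph_Z d) = {0..2 * d}"
  by (simp add: graph_Z_def graph_L_def)

lemma graph_Z_arc_iff:
  assumes "x < y"
  shows "(x, y) \<in> parcs (graph_Z d) \<longleftrightarrow>
    y \<le> 2 * d \<and> (y = x + 1 \<or> x + y = 2 * d \<or> x + y + 1 = 2 * d)"
proof -
  have "(x, y) \<in> parcs (graph_Z d) \<longleftrightarrow>
      y = x + 1 \<and> x < 2 * d \<or> y = 2 * d - x \<and> x < d \<or> y = 2 * d - 1 - x \<and> x + 2 \<le> d"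
    using assms by (auto simp: graph_Z_def graph_L_def symcl_def)
  also have "\<dots> \<longleftrightarrow> y = x + 1 \<and> y \<le> 2 * d \<or> x + y = 2 * d \<or> x + y + 1 = 2 * d \<and> x + 2 \<le> d"
    using assms by (intro disj_cong refl) linarith+
  also have "\<dots> \<longleftrightarrow> y \<le> 2 * d \<and> (y = x + 1 \<or> x + y = 2 * d \<or> x + y + 1 = 2 * d)"
    using assms by linarith
  finally show ?thesis .
qed

lemma graph_Zstar_pair_induce:
  "graph_Zstar d = with_proj (pair_induce (graph_Z d) ({0..2 * d} - {d}))"
proof -
  interpret Z: pair_graph "graph_Z d" by (rule pair_graph_Z)
  show ?thesis
    unfolding graph_Zstar_def with_proj_pair_induce
    using Z.wellformed' by (auto simp: pre_digraph.del_vert_def induce_subgraph_def pverts_graph_Z)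
qed

context zigzag_labelling
begin

lemma iso_graph_Z:
  assumes d: "n = 2 * int d + 1"
  shows "digraph_iso (with_proj G) (with_proj (graph_Z d))"
proof (rule digraph_iso_pair_linorderI[OF _ pair_graph_Z])
  have "bij_betw int (pverts (graph_Z d)) {0..<0 + n}"
    by (rule bij_betw_byWitness[where f' = nat]) (auto simp: d pverts_graph_Z)
  then show "bij_betw (c \<circ> int) (pverts (graph_Z d)) (pverts G)"
    using bij_betw_window by (rule bij_betw_trans)
  fix x y assume "x \<in> pverts (graph_Z d)" "y \<in> pverts (graph_Z d)" "x < y"
  then show "(x, y) \<in> parcs (graph_Z d) \<longleftrightarrow> adj ((c \<circ> int) x) ((c \<circ> int) y)"
    using zigzag[of "int x" "int y"] by (auto simp: graph_Z_arc_iff d pverts_graph_Z)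
qed (rule pair_graph)

lemma iso_graph_Zstar:
  assumes d: "n = 2 * int d"
  shows "digraph_iso (with_proj G) (graph_Zstar d)"
  unfolding graph_Zstar_pair_induce
proof (rule digraph_iso_pair_linorderI)
  let ?Z = "pair_induce (graph_Z d) ({0..2 * d} - {d})"
  let ?f = "\<lambda>x. if x < d then int x else int x - 1"
  show "pair_graph ?Z"
    by (intro pair_graph.pair_graph_pair_induce pair_graph_Z) (auto simp: pverts_graph_Z)
  have "bij_betw ?f (pverts ?Z) {0..<0 + n}"
    by (rule bij_betw_byWitness[where f' = "\<lambda>i. if i < int d then nat i else nat (i + 1)"])
      (auto simp: d)
  then show "bij_betw (c \<circ> ?f) (pverts ?Z) (pverts G)"
    using bij_betw_window by (rule bij_betw_trans)
  fix x y assume xy: "x \<in> pverts ?Z" "y \<in> pverts ?Z" "x < y"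
  then have "adj ((c \<circ> ?f) x) ((c \<circ> ?f) y) \<longleftrightarrow>
      ?f y = ?f x + 1 \<or> ?f x + ?f y = n - 1 \<or> ?f x + ?f y = n - 2"
    unfolding o_def by (intro zigzag) (auto simp: d)
  also have "\<dots> \<longleftrightarrow> (x, y) \<in> parcs ?Z"
    using xy by (auto simp: graph_Z_arc_iff d)
  finally show "(x, y) \<in> parcs ?Z \<longleftrightarrow> adj ((c \<circ> ?f) x) ((c \<circ> ?f) y)" ..
qed (rule pair_graph)

lemma iso_graph_Z_or_Zstar:
  "\<exists>d\<ge>1. digraph_iso (with_proj G) (with_proj (graph_Z d)) \<or>
    digraph_iso (with_proj G) (graph_Zstar d)"
proof -
  have "n = 2 * int (nat (n div 2)) + 1 \<or> n = 2 * int (nat (n div 2))" and "1 \<le> nat (n div 2)"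
    using three_le by linarith+
  then show ?thesis using iso_graph_Z iso_graph_Zstar by blast
qed

end

section \<open>Suns\<close>

lemma cong_int_less_iff:
  fixes a b t :: nat
  shows "a < t \<Longrightarrow> b < t \<Longrightarrow> [int a = int b] (mod int t) \<longleftrightarrow> a = b"
  by (simp add: cong_int_iff cong_def)

lemma cong_int_succ_iff:
  fixes a b t :: nat
  assumes "b < t"
  shows "[int b = int a + 1] (mod int t) \<longleftrightarrow> b = (a + 1) mod t"
proof -
  have "[int b = int a + 1] (mod int t) \<longleftrightarrow> [b = a + 1] (mod t)"
    using cong_int_iff[of b "a + 1" t] by (simp add: add.commute)
  then show ?thesis using assms by (simp add: cong_def)
qed

lemma pverts_sun_graph: "pverts (sun_graph t I) = Inl ` {..<t} \<union> Inr ` I"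
  by (simp add: sun_graph_def)

lemma sun_graph_arc_iff:
  "(Inl a, Inl b) \<in> parcs (sun_graph t I) \<longleftrightarrow>
    a < t \<and> b = (a + 1) mod t \<or> b < t \<and> a = (b + 1) mod t"
  "(Inr k, Inl b) \<in> parcs (sun_graph t I) \<longleftrightarrow> k \<in> I \<and> (b = k \<or> b = (k + 1) mod t)"
  "(Inl b, Inr k) \<in> parcs (sun_graph t I) \<longleftrightarrow> k \<in> I \<and> (b = k \<or> b = (k + 1) mod t)"
  "(Inr k, Inr l) \<notin> parcs (sun_graph t I)"
  by (auto simp: sun_graph_def symcl_def)

text \<open>
  The inner face has the corners \<open>p 0, \<dots>, p (t - 1)\<close>. The sequence \<open>p\<close> continues them around the
  labelling, so that \<open>t\<close> sides make up one period \<open>n\<close>.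
\<close>

locale sun_face = claw_free_noncrossing_labelling G c n
  for G :: "'a pair_pre_digraph" and c :: "int \<Rightarrow> 'a" and n :: int +
  fixes p :: "int \<Rightarrow> int" and t :: nat
  assumes three_le_sides: "3 \<le> t"
    and corner_succ: "p k < p (k + 1)"
    and corner_periods: "p (k + int t * m) = p k + n * m"
    and corners_adj_iff: "p k \<frown> p l \<longleftrightarrow> [l = k + 1] (mod int t) \<or> [k = l + 1] (mod int t)"
    and wide: "t = 3 \<Longrightarrow> p k + 2 \<le> p (k + 1)"
begin

lemma strict_mono_corner: "strict_mono p"
proof (rule strict_monoI)
  fix k l :: int assume "k < l"
  then show "p k < p l"
    by (induction l rule: int_gr_induct) (use corner_succ less_trans in blast)+
qed

lemmas corner_less_iff = strict_mono_less[OF strict_mono_corner]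
lemmas corner_le_iff = strict_mono_less_eq[OF strict_mono_corner]

lemma corner_period: "p (k + int t) = p k + n"
  using corner_periods[of k 1] by simp

lemma side: "p k \<frown> p (k + 1)"
  by (simp add: corners_adj_iff)

lemma label_corner_cong:
  assumes "[k = l] (mod int t)"
  shows "c (p k) = c (p l)"
proof -
  obtain m where "l = k + int t * m" using assms by (auto simp: cong_iff_lin)
  then show ?thesis by (simp add: corner_periods label_add_periods)
qed

lemma next_but_one_not_adj:
  assumes "4 \<le> t"
  shows "\<not> p k \<frown> p (k + 2)"
proof -
  have "\<not> int t dvd 1" "\<not> int t dvd 3"
    using assms zdvd_imp_le[of "int t"] by fastforce+
  then show ?thesis
    by (auto simp: corners_adj_iff cong_iff_dvd_diff dvd_diff_commute)
qed

lemma sun_face_reflect: "sun_face G (\<lambda>i. c (0 - i)) n (\<lambda>k. - p (- k)) t"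
proof -
  interpret reflect: claw_free_noncrossing_labelling G "\<lambda>i. c (0 - i)" n
    by (rule labelling_reflect)
  show ?thesis
  proof
    show "- p (- k) < - p (- (k + 1))" for k
      using corner_succ[of "- k - 1"] by simp
    show "- p (- (k + int t * m)) = - p (- k) + n * m" for k m
      using corner_periods[of "- k" "- m"] by simp
    show "adj (c (0 - - p (- k))) (c (0 - - p (- l))) \<longleftrightarrow>
        [l = k + 1] (mod int t) \<or> [k = l + 1] (mod int t)" for k l
      by (simp add: corners_adj_iff cong_iff_dvd_diff algebra_simps disj_commute)
    show "- p (- k) + 2 \<le> - p (- (k + 1))" if "t = 3" for k
      using wide[OF that, of "- k - 1"] by simp
  qed (rule three_le_sides)
qed

lemma long_side_chord:
  assumes long: "p k + 3 \<le> p (k + 1)"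
  shows "p k + 1 \<frown> p (k + 1)"
proof -
  have prev: "p (k - 1) < p k" "p (k - 1) \<frown> p k"
    using corner_succ[of "k - 1"] side[of "k - 1"] by simp_all
  have "p (k + 1) < p (k - 1 + int t)"
    using three_le_sides by (simp add: corner_less_iff)
  then have following: "p (k + 1) < p (k - 1) + n"
    by (simp add: corner_period)
  have "\<not> p k - 1 \<frown> p (k + 1)"
  proof (cases "p (k - 1) = p k - 1")
    case True
    then have "4 \<le> t" using wide[of "k - 1"] three_le_sides by (cases "t = 3") auto
    then show ?thesis using next_but_one_not_adj[of "k - 1"] True by (simp add: add.commute)
  next
    case False
    then show ?thesis
      using noncrossing[of "p (k - 1)" "p k - 1" "p k" "p (k + 1)"] prev long following by auto
  qed
  moreover have "\<not> p k - 1 \<frown> p k + 1"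
    using noncrossing[of "p k - 1" "p k" "p k + 1" "p (k + 1)"] side[of k] prev long following
    by auto
  ultimately show ?thesis
    using claw_labels[of "p k - 1" "p k + 1" "p (k + 1)" "p k"] adj_pred adj_succ side[of k]
      prev long following by auto
qed

lemma side_length: "p (k + 1) \<le> p k + 2"
proof (rule ccontr)
  interpret reflect: sun_face G "\<lambda>i. c (0 - i)" n "\<lambda>k. - p (- k)" t
    by (rule sun_face_reflect)
  assume "\<not> ?thesis"
  then have long: "p k + 3 \<le> p (k + 1)" by simp
  have "p k + 1 \<frown> p (k + 1)"
    using long by (rule long_side_chord)
  moreover have "p (k + 1) - 1 \<frown> p k"
    using reflect.long_side_chord[of "- k - 1"] long by (simp add: algebra_simps)
  moreover have "p (k + 1) < p k + n"
    using corner_less_iff[of "k + 1" "k + int t"] three_le_sides by (simp add: corner_period)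
  ultimately show False
    using noncrossing[of "p k" "p k + 1" "p (k + 1) - 1" "p (k + 1)"] long label_adj_commute by auto
qed

text \<open>
  The vertices behind the capped sides become the vertices \<open>r\<^sub>i\<close> of the sun.
\<close>

definition capped :: "int \<Rightarrow> bool" where
  "capped k \<longleftrightarrow> p (k + 1) = p k + 2"

lemma corner_representativeE:
  obtains l' m where "k \<le> l'" "l' < k + int t" "[l' = l] (mod int t)" "p l' = p l + n * m"
    "capped l' \<longleftrightarrow> capped l"
proof -
  define m where "m = - ((l - k) div int t)"
  have "l + int t * m = k + (l - k) mod int t"
    by (simp add: m_def minus_mult_div_eq_mod[symmetric])
  moreover have "0 \<le> (l - k) mod int t" "(l - k) mod int t < int t"
    using three_le_sides by simp_all
  moreover have "capped (l + int t * m) \<longleftrightarrow> capped l"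
    using corner_periods[of "l + 1" m] corner_periods[of l m] by (simp add: capped_def ac_simps)
  moreover have "[l + int t * m = l] (mod int t)"
    by (simp add: cong_iff_dvd_diff)
  ultimately show thesis
    using that[of "l + int t * m" m] corner_periods[of l m] by simp
qed

lemma cap_not_adj:
  assumes "capped k" "p k + 2 < z" "z < p k + n"
  shows "\<not> p k + 1 \<frown> z"
  using noncrossing[of "p k" "p k + 1" "p k + 2" z] side[of k] assms by (auto simp: capped_def)

lemma cap_adj_corner_iff:
  assumes "capped k"
  shows "p k + 1 \<frown> p l \<longleftrightarrow> [l = k] (mod int t) \<or> [l = k + 1] (mod int t)"
proof
  assume adj: "p k + 1 \<frown> p l"
  obtain l' m where l': "k \<le> l'" "l' < k + int t" "[l' = l] (mod int t)" "p l' = p l + n * m"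
    by (rule corner_representativeE)
  have "l' \<le> k + 1"
  proof (rule ccontr)
    assume "\<not> ?thesis"
    then have "p k + 2 < p l'"
      using corner_less_iff[of "k + 1" l'] assms by (simp add: capped_def)
    moreover have "p l' < p k + n"
      using corner_less_iff[of l' "k + int t"] l'(2) by (simp add: corner_period)
    moreover have "p k + 1 \<frown> p l'"
      using adj by (simp add: l'(4) label_add_periods)
    ultimately show False using cap_not_adj[OF assms] by blast
  qed
  then have "l' = k \<or> l' = k + 1" using l'(1) by linarith
  then show "[l = k] (mod int t) \<or> [l = k + 1] (mod int t)"
    using l'(3) cong_sym by blast
next
  have "p k + 1 \<frown> p k" "p k + 1 \<frown> p (k + 1)"
    using adj_pred[of "p k + 1"] adj_succ[of "p k + 1"] assms
    by (simp_all add: capped_def add.commute)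
  moreover assume "[l = k] (mod int t) \<or> [l = k + 1] (mod int t)"
  ultimately show "p k + 1 \<frown> p l"
    using label_corner_cong by metis
qed

lemma caps_not_adj:
  assumes "capped k" "capped l"
  shows "\<not> p k + 1 \<frown> p l + 1"
proof -
  obtain l' m where l': "k \<le> l'" "l' < k + int t" "p l' = p l + n * m" "capped l'"
    using corner_representativeE[of k l] assms(2) by metis
  have "\<not> p k + 1 \<frown> p l' + 1"
  proof (cases "l' = k")
    case True
    then show ?thesis using no_loops' by blast
  next
    case False
    then have "p k + 2 \<le> p l'" "p (l' + 1) \<le> p k + n"
      using l'(1,2) assms(1) corner_le_iff[of "k + 1" l'] corner_le_iff[of "l' + 1" "k + int t"]
      by (simp_all add: capped_def corner_period)
    then show ?thesis
      using cap_not_adj[OF assms(1)] l'(4) by (simp add: capped_def)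
  qed
  moreover have "c (p l' + 1) = c (p l + 1)"
    using label_add_periods[of "p l + 1" m] by (simp add: l'(3) algebra_simps)
  ultimately show ?thesis by simp
qed

definition caps :: "nat set" where
  "caps = {k. k < t \<and> capped (int k)}"

definition sun_position :: "nat + nat \<Rightarrow> int" where
  "sun_position = case_sum (\<lambda>k. p (int k)) (\<lambda>k. p (int k) + 1)"

lemma sun_position_simps [simp]:
  "sun_position (Inl k) = p (int k)"
  "sun_position (Inr k) = p (int k) + 1"
  by (simp_all add: sun_position_def)

lemma window_subset_sun_positions:
  assumes "p 0 \<le> z" "z < p 0 + n"
  shows "z \<in> sun_position ` pverts (sun_graph t caps)"
proof -
  have "z < p (int t)" "\<not> z < p (int 0)"
    using assms corner_period[of 0] by simp_all
  then obtain k where k: "k < t" "\<not> z < p (int k)" "z < p (int (Suc k))"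
    using ex_least_nat_less[of "\<lambda>k. z < p (int k)" t] by blast
  then consider (corner) "z = p (int k)" | (cap) "z = p (int k) + 1" "capped (int k)"
    using side_length[of "int k"] by (fastforce simp: capped_def add.commute)
  then show ?thesis
  proof cases
    case corner
    then show ?thesis using k(1) by (intro image_eqI[of _ _ "Inl k"]) (auto simp: pverts_sun_graph)
  next
    case cap
    then show ?thesis
      using k(1) by (intro image_eqI[of _ _ "Inr k"]) (auto simp: pverts_sun_graph caps_def)
  qed
qed

lemma bij_betw_sun_position: "bij_betw sun_position (pverts (sun_graph t caps)) {p 0..<p 0 + n}"
proof (rule bij_betw_imageI)
  have off_corner: "p k + 1 \<noteq> p l" if "capped k" for k l
    using that corner_less_iff[of k l] corner_le_iff[of "k + 1" l] by (auto simp: capped_def)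
  show "inj_on sun_position (pverts (sun_graph t caps))"
    using off_corner strict_mono_eq[OF strict_mono_corner]
    by (auto simp: inj_on_def pverts_sun_graph caps_def) metis
  have bounds: "p 0 \<le> p (int k)" "p (int k + 1) \<le> p 0 + n" if "k < t" for k
    using that corner_le_iff[of 0 "int k"] corner_le_iff[of "int k + 1" "int t"] corner_period[of 0]
    by simp_all
  have "sun_position x \<in> {p 0..<p 0 + n}" if "x \<in> pverts (sun_graph t caps)" for x
  proof -
    from that consider (corner) k where "k < t" "sun_position x = p (int k)"
      | (cap) k where "k < t" "capped (int k)" "sun_position x = p (int k) + 1"
      by (auto simp: pverts_sun_graph caps_def)
    then show ?thesis
    proof cases
      case (corner k)
      then show ?thesis using bounds[of k] corner_succ[of "int k"] by simp
    next
      case (cap k)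
      then show ?thesis using bounds[of k] by (simp add: capped_def)
    qed
  qed
  then show "sun_position ` pverts (sun_graph t caps) = {p 0..<p 0 + n}"
    using window_subset_sun_positions by auto
qed

lemma iso_sun_graph: "digraph_iso (with_proj G) (with_proj (sun_graph t caps))"
proof (rule digraph_iso_pairI)
  show "pair_graph G" by (rule pair_graph)
  show "pair_graph (sun_graph t caps)"
    by (rule pair_graph_S[OF three_le_sides]) (auto simp: graphs_S_def caps_def)
  show "bij_betw (c \<circ> sun_position) (pverts (sun_graph t caps)) (pverts G)"
    using bij_betw_sun_position bij_betw_window by (rule bij_betw_trans)
  have adj_cap: "p (int k) + 1 \<frown> p (int b) \<longleftrightarrow> b = k \<or> b = (k + 1) mod t"
    if "k \<in> caps" "b < t" for k b
    using that by (simp add: caps_def cap_adj_corner_iff cong_int_less_iff cong_int_succ_iff)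
  fix x y assume "x \<in> pverts (sun_graph t caps)" "y \<in> pverts (sun_graph t caps)"
  then consider (corner_corner) a b where "x = Inl a" "y = Inl b" "a < t" "b < t"
    | (cap_corner) k b where "x = Inr k" "y = Inl b" "k \<in> caps" "b < t"
    | (corner_cap) k b where "x = Inl b" "y = Inr k" "k \<in> caps" "b < t"
    | (cap_cap) k l where "x = Inr k" "y = Inr l" "k \<in> caps" "l \<in> caps"
    by (auto simp: pverts_sun_graph)
  then show "(x, y) \<in> parcs (sun_graph t caps) \<longleftrightarrow> adj ((c \<circ> sun_position) x) ((c \<circ> sun_position) y)"
  proof cases
    case corner_corner
    then show ?thesis by (simp add: sun_graph_arc_iff corners_adj_iff cong_int_succ_iff)
  next
    case cap_corner
    then show ?thesis by (simp add: sun_graph_arc_iff adj_cap)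
  next
    case corner_cap
    then show ?thesis
      using adj_commute[of "c (p (int b))"] by (simp add: sun_graph_arc_iff adj_cap)
  next
    case cap_cap
    then show ?thesis using caps_not_adj by (simp add: sun_graph_arc_iff caps_def)
  qed
qed

lemma iso_graphs_S: "\<exists>H\<in>graphs_S t. digraph_iso (with_proj G) (with_proj H)"
  using iso_sun_graph by (rule bexI) (auto simp: graphs_S_def caps_def)

end

context claw_free_noncrossing_labelling
begin

definition periodic_extension :: "int list \<Rightarrow> int \<Rightarrow> int" where
  "periodic_extension ps k = ps ! nat (k mod int (length ps)) + n * (k div int (length ps))"

lemma periodic_extension_add_periods:
  assumes "ps \<noteq> []"
  shows "periodic_extension ps (k + int (length ps) * m) = periodic_extension ps k + n * m"
  using assms by (simp add: periodic_extension_def distrib_left)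

lemma periodic_extension_nth:
  assumes "i < length ps"
  shows "periodic_extension ps (int i + int (length ps) * q) = ps ! i + n * q"
proof -
  have "periodic_extension ps (int i) = ps ! i"
    using assms by (simp add: periodic_extension_def)
  moreover have "ps \<noteq> []" using assms by auto
  ultimately show ?thesis by (simp add: periodic_extension_add_periods)
qed

lemma periodic_indexE:
  fixes k :: int
  assumes "ps \<noteq> []"
  obtains i q where "i < length ps" "k = int i + int (length ps) * q"
proof
  show "nat (k mod int (length ps)) < length ps"
    using assms by (simp add: nat_less_iff)
  show "k = int (nat (k mod int (length ps))) + int (length ps) * (k div int (length ps))"
    using assms by simp
qed

lemma periodic_extension_succ:
  assumes ne: "ps \<noteq> []" and ps: "successively R ps" "R (last ps) (hd ps + n)"
    and translate: "\<And>x y m. R x y \<Longrightarrow> R (x + n * m) (y + n * m)"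
  shows "R (periodic_extension ps k) (periodic_extension ps (k + 1))"
proof -
  obtain i q where i: "i < length ps" and k: "k = int i + int (length ps) * q"
    using periodic_indexE[OF ne] .
  show ?thesis
  proof (cases "Suc i < length ps")
    case True
    have succ: "k + 1 = int (Suc i) + int (length ps) * q" by (simp add: k)
    have "R (ps ! i + n * q) (ps ! Suc i + n * q)"
      using translate successively_nth[OF ps(1) True] by blast
    then show ?thesis
      unfolding succ periodic_extension_nth[OF True] unfolding k periodic_extension_nth[OF i] .
  next
    case False
    then have succ: "k + 1 = int 0 + int (length ps) * (q + 1)" and "ps ! i = last ps"
      using i ne by (auto simp: k distrib_left last_conv_nth intro: arg_cong[of _ _ "(!) ps"])
    then have "R (ps ! i + n * q) (ps ! 0 + n * (q + 1))"
      using translate[OF ps(2), of q] ne by (simp add: hd_conv_nth distrib_left ac_simps)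
    then show ?thesis
      using ne unfolding succ
      by (subst periodic_extension_nth) (simp_all add: k periodic_extension_nth[OF i])
  qed
qed

definition ascending_detour :: "int \<Rightarrow> int \<Rightarrow> int list \<Rightarrow> bool" where
  "ascending_detour i j ps \<longleftrightarrow> 3 \<le> length ps \<and> hd ps = i \<and> last ps = j \<and>
    successively (\<lambda>x y. x < y \<and> x \<frown> y) ps"

lemma ascending_detour_increasing: "ascending_detour i j ps \<Longrightarrow> successively (<) ps"
  unfolding ascending_detour_def by (auto intro: successively_mono[where P = "\<lambda>x y. x < y \<and> x \<frown> y"])

definition chordless :: "int list \<Rightarrow> bool" where
  "chordless ps \<longleftrightarrow> (\<forall>a b. a + 2 \<le> b \<longrightarrow> b < length ps \<longrightarrow> b + 2 \<le> a + length ps \<longrightarrow> \<not> ps ! a \<frown> ps ! b)"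

lemma chordless_detour_adj_iff_less:
  assumes ps: "ascending_detour i j ps" "chordless ps" and "i \<frown> j"
    and ab: "a < b" "b < length ps"
  shows "ps ! a \<frown> ps ! b \<longleftrightarrow> b = a + 1 \<or> a = 0 \<and> b = length ps - 1"
proof
  assume "ps ! a \<frown> ps ! b"
  then have "\<not> (a + 2 \<le> b \<and> b + 2 \<le> a + length ps)"
    using ps(2) ab by (auto simp: chordless_def)
  then show "b = a + 1 \<or> a = 0 \<and> b = length ps - 1" using ab by linarith
next
  have "ps ! 0 \<frown> ps ! (length ps - 1)"
    using ps(1) \<open>i \<frown> j\<close>
    by (cases "ps = []") (auto simp: ascending_detour_def hd_conv_nth last_conv_nth)
  moreover assume "b = a + 1 \<or> a = 0 \<and> b = length ps - 1"
  ultimately show "ps ! a \<frown> ps ! b"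
    using ps(1) ab successively_nth[of "\<lambda>x y. x < y \<and> x \<frown> y" ps a]
    by (auto simp: ascending_detour_def)
qed

lemma chordless_detour_adj_iff:
  assumes ps: "ascending_detour i j ps" "chordless ps" "i \<frown> j"
    and ab: "a < length ps" "b < length ps"
  shows "ps ! a \<frown> ps ! b \<longleftrightarrow> b = (a + 1) mod length ps \<or> a = (b + 1) mod length ps"
proof -
  have succ: "b = (a + 1) mod length ps \<longleftrightarrow> b = a + 1 \<or> b = 0 \<and> a = length ps - 1"
    "a = (b + 1) mod length ps \<longleftrightarrow> a = b + 1 \<or> a = 0 \<and> b = length ps - 1"
    using ab by (auto simp: mod_Suc)
  show ?thesis
  proof (cases a b rule: linorder_cases)
    case less
    then show ?thesis unfolding succ chordless_detour_adj_iff_less[OF ps less ab(2)] by auto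
  next
    case equal
    then show ?thesis
      unfolding succ using no_loops' ps(1) ab by (auto simp: ascending_detour_def)
  next
    case greater
    then show ?thesis
      unfolding succ label_adj_commute[of "ps ! a"]
        chordless_detour_adj_iff_less[OF ps greater ab(1)]
      by auto
  qed
qed

lemma sun_face_of_chordless_detour:
  assumes ps: "ascending_detour i j ps" "chordless ps" and ij: "i \<frown> j" "j < i + n"
    and wide: "length ps = 3 \<Longrightarrow> successively (\<lambda>x y. x + 2 \<le> y) (ps @ [i + n])"
  shows "sun_face G c n (periodic_extension ps) (length ps)"
proof
  have len: "3 \<le> length ps" and ne: "ps \<noteq> []" and ends: "hd ps = i" "last ps = j"
    using ps(1) by (auto simp: ascending_detour_def)
  show "3 \<le> length ps" by (rule len)
  show "periodic_extension ps (k + int (length ps) * m) = periodic_extension ps k + n * m" for k m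
    using ne by (rule periodic_extension_add_periods)
  show "periodic_extension ps k < periodic_extension ps (k + 1)" for k
    by (rule periodic_extension_succ[where R = "(<)", OF ne ascending_detour_increasing[OF ps(1)]])
      (use ij(2) ends in simp_all)
  show "periodic_extension ps k + 2 \<le> periodic_extension ps (k + 1)" if "length ps = 3" for k
    by (rule periodic_extension_succ[where R = "\<lambda>x y. x + 2 \<le> y", OF ne])
      (use wide[OF that] ends ne in \<open>simp_all add: successively_append_iff\<close>)
  show "periodic_extension ps k \<frown> periodic_extension ps l \<longleftrightarrow>
      [l = k + 1] (mod int (length ps)) \<or> [k = l + 1] (mod int (length ps))" for k l
  proof -
    obtain a q where a: "a < length ps" and k: "k = int a + int (length ps) * q"
      using periodic_indexE[OF ne] .
    obtain b r where b: "b < length ps" and l: "l = int b + int (length ps) * r"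
      using periodic_indexE[OF ne] .
    have succ: "k + 1 = int a + 1 + int (length ps) * q" "l + 1 = int b + 1 + int (length ps) * r"
      by (simp_all add: k l)
    have cong: "[l = k + 1] (mod int (length ps)) \<longleftrightarrow> [int b = int a + 1] (mod int (length ps))"
      "[k = l + 1] (mod int (length ps)) \<longleftrightarrow> [int a = int b + 1] (mod int (length ps))"
      unfolding succ unfolding k l by (simp_all add: cong_def)
    have "periodic_extension ps k \<frown> periodic_extension ps l \<longleftrightarrow> ps ! a \<frown> ps ! b"
      unfolding k l by (simp add: periodic_extension_nth a b label_add_periods)
    then show ?thesis
      unfolding cong cong_int_succ_iff[OF a] cong_int_succ_iff[OF b]
      using chordless_detour_adj_iff[OF ps ij(1) a b] by simp
  qed
qed

lemma ascending_detour_shortcut: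
  assumes ps: "ascending_detour i j ps" and ab: "a + 2 \<le> b" "b < length ps" "b + 2 \<le> a + length ps"
    and chord: "ps ! a \<frown> ps ! b"
  shows "ascending_detour i j (take (Suc a) ps @ drop b ps)"
proof -
  let ?R = "\<lambda>x y. x < y \<and> x \<frown> y"
  have "successively ?R ps" using ps by (simp add: ascending_detour_def)
  then have "successively ?R (take (Suc a) ps @ drop (Suc a) ps)"
    "successively ?R (take b ps @ drop b ps)"
    by simp_all
  then have "successively ?R (take (Suc a) ps)" "successively ?R (drop b ps)"
    unfolding successively_append_iff by blast+
  moreover have "last (take (Suc a) ps) = ps ! a" "hd (drop b ps) = ps ! b"
    using ab by (auto simp: take_Suc_conv_app_nth hd_drop_conv_nth)
  moreover have "ps ! a < ps ! b"
    using ascending_detour_increasing[OF ps] ab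
    by (simp add: successively_conv_sorted_wrt sorted_wrt_nth_less)
  ultimately have "successively ?R (take (Suc a) ps @ drop b ps)"
    using chord by (auto simp: successively_append_iff)
  then show ?thesis
    using ps ab by (auto simp: ascending_detour_def hd_append)
qed

lemma chordless_detour_exists:
  assumes "i + 2 \<le> j"
  shows "\<exists>ps. ascending_detour i j ps \<and> chordless ps"
proof -
  have "successively (\<lambda>x y. x < y \<and> x \<frown> y) [i..j]"
    using adj_succ[of "i + int k" for k] by (auto simp: successively_conv_nth ac_simps)
  then have "ascending_detour i j [i..j]"
    using assms by (auto simp: ascending_detour_def hd_conv_nth last_conv_nth)
  then obtain ps where ps: "ascending_detour i j ps"
    and shortest: "\<And>qs. ascending_detour i j qs \<Longrightarrow> length ps \<le> length qs"
    using ex_has_least_nat[of "ascending_detour i j" _ length] by blast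
  have "chordless ps"
    unfolding chordless_def
  proof (intro allI impI notI)
    fix a b assume ab: "a + 2 \<le> b" "b < length ps" "b + 2 \<le> a + length ps" "ps ! a \<frown> ps ! b"
    then have "length ps \<le> length (take (Suc a) ps @ drop b ps)"
      using shortest ascending_detour_shortcut[OF ps] by blast
    then show False using ab(1,2) by simp
  qed
  with ps show ?thesis by blast
qed

lemma untriangulated_imp_sun_face:
  assumes "\<not> triangulated"
  shows "\<exists>p t. sun_face G c n p t"
proof -
  obtain i j where ij: "i + 2 \<le> j" "j < i + n" "i \<frown> j"
    and no_triangle: "\<And>k. i < k \<Longrightarrow> k < j \<Longrightarrow> i \<frown> k \<Longrightarrow> \<not> k \<frown> j"
    using assms unfolding triangulated_def by blast
  obtain ps where ps: "ascending_detour i j ps" "chordless ps"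
    using chordless_detour_exists[OF ij(1)] by blast
  have "length ps \<noteq> 3"
  proof
    assume "length ps = 3"
    then obtain k where "ps = [i, k, j]"
      using ps(1) by (auto simp: ascending_detour_def length_Suc_conv eval_nat_numeral)
    then show False using ps(1) no_triangle[of k] by (simp add: ascending_detour_def)
  qed
  then show ?thesis
    using sun_face_of_chordless_detour[OF ps ij(3,2)] by blast
qed

lemma inner_triangle_imp_sun_face:
  assumes "inner_triangle i k j"
  shows "\<exists>p t. sun_face G c n p t"
proof -
  have "chordless [i, k, j]" by (auto simp: chordless_def)
  moreover have "ascending_detour i j [i, k, j]"
    using assms by (simp add: ascending_detour_def inner_triangle_def)
  ultimately have "sun_face G c n (periodic_extension [i, k, j]) (length [i, k, j])"
    using assms by (intro sun_face_of_chordless_detour) (auto simp: inner_triangle_def)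
  then show ?thesis by blast
qed

lemma iso_zigzag_or_sun:
  "(\<exists>d\<ge>1. digraph_iso (with_proj G) (with_proj (graph_Z d)) \<or>
      digraph_iso (with_proj G) (graph_Zstar d)) \<or>
    (\<exists>t\<ge>3. \<exists>H\<in>graphs_S t. digraph_iso (with_proj G) (with_proj H))"
proof (cases "\<exists>p t. sun_face G c n p t")
  case True
  then obtain p t where "sun_face G c n p t" by blast
  then show ?thesis using sun_face.iso_graphs_S sun_face.three_le_sides by blast
next
  case False
  then have triangulated "\<And>i k j. \<not> inner_triangle i k j"
    using untriangulated_imp_sun_face inner_triangle_imp_sun_face by blast+
  then obtain b where "zigzag_labelling G b n"
    using triangulated_imp_zigzag by blast
  then show ?thesis using zigzag_labelling.iso_graph_Z_or_Zstar by blast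
qed

end

section \<open>Outerplanar drawings\<close>

lemma plane_embedding_straight_line:
  assumes G: "pair_graph G" and inj: "inj_on p (pverts G)"
    and vertex: "\<And>u v w. (u, v) \<in> parcs G \<Longrightarrow> w \<in> pverts G \<Longrightarrow>
      p w \<in> closed_segment (p u) (p v) \<Longrightarrow> w = u \<or> w = v"
    and meet: "\<And>u v x y. (u, v) \<in> parcs G \<Longrightarrow> (x, y) \<in> parcs G \<Longrightarrow> {u, v} \<noteq> {x, y} \<Longrightarrow>
      closed_segment (p u) (p v) \<inter> closed_segment (p x) (p y) \<subseteq> p ` pverts G"
  shows "plane_embedding G p (\<lambda>S. convex hull (p ` S))"
proof -
  interpret G: pair_graph G by fact
  have hull: "convex hull (p ` {u, v}) = closed_segment (p u) (p v)" for u v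
    by (simp add: segment_convex_hull)
  have segment: "(\<exists>g. arc g \<and> path_image g = closed_segment (p u) (p v) \<and>
        pathstart g = p u \<and> pathfinish g = p v) \<and>
      closed_segment (p u) (p v) \<inter> p ` pverts G = {p u, p v}" if uv: "(u, v) \<in> parcs G" for u v
  proof
    have "p u \<noteq> p v"
      using inj_onD[OF inj] G.wellformed'[OF uv] G.no_loops'[OF uv] by blast
    then show "\<exists>g. arc g \<and> path_image g = closed_segment (p u) (p v) \<and>
        pathstart g = p u \<and> pathfinish g = p v"
      by (intro exI[of _ "linepath (p u) (p v)"]) simp
    show "closed_segment (p u) (p v) \<inter> p ` pverts G = {p u, p v}"
      using vertex[OF uv] G.wellformed'[OF uv] by auto
  qed
  show ?thesis
    unfolding plane_embedding_def hull using inj segment meet by fast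
qed

lemma frontier_outside_of_convex_superset:
  fixes D :: "'a::{real_normed_vector, perfect_space} set"
  assumes "convex A" "D \<subseteq> A" "z \<in> D" "z \<in> frontier A"
  shows "z \<in> frontier (outside D)"
proof -
  have "- A \<subseteq> outside D"
    using outside_mono[OF assms(2)] outside_convex[OF assms(1)] by blast
  then have "z \<in> closure (outside D)"
    using assms(4) closure_mono unfolding frontier_closures by blast
  moreover have "z \<notin> interior (outside D)"
    using assms(3) outside_no_overlap interior_subset by blast
  ultimately show ?thesis by (simp add: frontier_def)
qed

lemma outerplanar_straight_lineI:
  assumes emb: "plane_embedding G p (\<lambda>S. convex hull (p ` S))"
    and G: "pair_graph G" and A: "convex A" "closed A" "p ` pverts G \<subseteq> frontier A"
  shows "outerplanar G"
proof -
  interpret G: pair_graph G by fact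
  let ?D = "drawing G p (\<lambda>S. convex hull (p ` S))"
  have "p ` pverts G \<subseteq> A"
    using A(3) frontier_subset_closed[OF A(2)] by blast
  then have "convex hull (p ` {u, v}) \<subseteq> A" if "(u, v) \<in> parcs G" for u v
    using G.wellformed'[OF that] A(1) by (intro hull_minimal) auto
  then have "?D \<subseteq> A"
    using \<open>p ` pverts G \<subseteq> A\<close> by (auto simp: drawing_def)
  moreover have "p ` pverts G \<subseteq> ?D"
    by (auto simp: drawing_def)
  ultimately have "p ` pverts G \<subseteq> frontier (outside ?D)"
    using A(1,3) by (auto intro!: frontier_outside_of_convex_superset[of A])
  with emb show ?thesis unfolding outerplanar_def by blast
qed

definition parabola :: "int \<Rightarrow> complex" where
  "parabola i = Complex (of_int i) ((of_int i)\<^sup>2)"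

lemma parabola_eq_iff [simp]: "parabola i = parabola j \<longleftrightarrow> i = j"
  by (auto simp: parabola_def)

lemma convex_above_parabola: "convex {z. (Re z)\<^sup>2 \<le> Im z}"
proof (rule convexI)
  fix x y :: complex and u v :: real
  assume xy: "x \<in> {z. (Re z)\<^sup>2 \<le> Im z}" "y \<in> {z. (Re z)\<^sup>2 \<le> Im z}"
    and uv: "0 \<le> u" "0 \<le> v" "u + v = 1"
  have u: "u = 1 - v" using uv(3) by simp
  have "(u * Re x + v * Re y)\<^sup>2 \<le> u * (Re x)\<^sup>2 + v * (Re y)\<^sup>2"
    using convex_onD[OF convex_power2, of v "Re x" "Re y"] uv(1,2) by (simp add: u)
  also have "\<dots> \<le> u * Im x + v * Im y"
    using xy uv by (intro add_mono mult_left_mono) auto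
  finally show "u *\<^sub>R x + v *\<^sub>R y \<in> {z. (Re z)\<^sup>2 \<le> Im z}" by simp
qed

lemma closed_above_parabola: "closed {z. (Re z)\<^sup>2 \<le> Im z}"
  by (intro closed_Collect_le continuous_intros)

lemma parabola_in_frontier: "parabola i \<in> frontier {z. (Re z)\<^sup>2 \<le> Im z}"
proof -
  let ?A = "{z :: complex. (Re z)\<^sup>2 \<le> Im z}"
  have "\<exists>y\<in>- ?A. dist y (parabola i) < e" if "0 < e" for e :: real
    using that
    by (intro bexI[of _ "parabola i - Complex 0 (e / 2)"])
      (auto simp: dist_norm parabola_def complex_norm)
  then have "parabola i \<in> closure (- ?A)"
    by (simp add: closure_approachable)
  moreover have "parabola i \<in> closure ?A"
    by (intro closure_subset[THEN subsetD]) (simp add: parabola_def)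
  ultimately show ?thesis by (simp add: frontier_closures)
qed

lemma parabola_chord:
  assumes "z \<in> closed_segment (parabola i) (parabola j)"
  shows "Im z = (Re z)\<^sup>2 + (Re z - of_int i) * (of_int j - Re z)"
    and "i \<le> j \<Longrightarrow> of_int i \<le> Re z \<and> Re z \<le> of_int j"
proof -
  obtain u where u: "0 \<le> u" "u \<le> 1" "z = (1 - u) *\<^sub>R parabola i + u *\<^sub>R parabola j"
    using assms by (auto simp: closed_segment_def)
  have re: "Re z = of_int i + u * (of_int j - of_int i)"
    by (simp add: u(3) parabola_def algebra_simps)
  show "Im z = (Re z)\<^sup>2 + (Re z - of_int i) * (of_int j - Re z)"
    unfolding re by (simp add: u(3) parabola_def power2_eq_square algebra_simps)
  show "of_int i \<le> Re z \<and> Re z \<le> of_int j" if "i \<le> j"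
    using that u(1,2) mult_left_le_one_le[of "of_int j - of_int i :: real" u] by (simp add: re)
qed

lemma parabola_on_chord:
  "parabola k \<in> closed_segment (parabola i) (parabola j) \<Longrightarrow> k = i \<or> k = j"
  using parabola_chord(1) by (fastforce simp: parabola_def)

lemma parabola_chord_end:
  assumes "z \<in> closed_segment (parabola i) (parabola j)"
  shows "Re z = of_int i \<Longrightarrow> z = parabola i" and "Re z = of_int j \<Longrightarrow> z = parabola j"
  using parabola_chord(1)[OF assms] by (simp_all add: parabola_def complex_eq_iff)

lemma parabola_nested_chords_meet:
  assumes outer: "z \<in> closed_segment (parabola i) (parabola j)"
    and inner: "z \<in> closed_segment (parabola k) (parabola l)"
    and nested: "i \<le> k" "k < l" "l \<le> j" "(i, j) \<noteq> (k, l)"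
  shows "z = parabola k \<or> z = parabola l"
proof -
  define x where "x = Re z"
  have x: "of_int k \<le> x" "x \<le> of_int l"
    using parabola_chord(2)[OF inner] nested by (auto simp: x_def)
  have "(x - of_int i) * (of_int j - x) = (x - of_int k) * (of_int l - x)"
    using parabola_chord(1)[OF outer] parabola_chord(1)[OF inner] by (simp add: x_def)
  then have sum: "(x - of_int k) * of_int (j - l) + of_int (k - i) * (of_int l - x)
      + of_int (k - i) * of_int (j - l) = 0"
    by (simp add: algebra_simps)
  have "0 \<le> (x - of_int k) * of_int (j - l)" "0 \<le> of_int (k - i) * (of_int l - x)"
    "0 \<le> (of_int (k - i) * of_int (j - l) :: real)"
    using x nested by (auto intro!: mult_nonneg_nonneg)
  then have "(x - of_int k) * of_int (j - l) = 0" "of_int (k - i) * (of_int l - x) = 0"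
    using sum by linarith+
  then have "x = of_int k \<or> x = of_int l"
    using nested by auto
  then show ?thesis
    using parabola_chord_end[OF inner] by (auto simp: x_def)
qed

lemma parabola_noncrossing_chords_meet:
  assumes z: "z \<in> closed_segment (parabola i) (parabola j)"
      "z \<in> closed_segment (parabola k) (parabola l)"
    and ord: "i < j" "k < l" "(i, j) \<noteq> (k, l)"
    and noncrossing: "\<not> (i < k \<and> k < j \<and> j < l)" "\<not> (k < i \<and> i < l \<and> l < j)"
  shows "z \<in> parabola ` {i, j, k, l}"
proof -
  have "of_int i \<le> Re z" "Re z \<le> of_int j" "of_int k \<le> Re z" "Re z \<le> of_int l"
    using parabola_chord(2) z ord by auto
  consider (nested) "i \<le> k" "l \<le> j" | (enclosing) "k \<le> i" "j \<le> l" | (left) "j \<le> k" | (right) "l \<le> i"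
    using noncrossing by linarith
  then show ?thesis
  proof cases
    case nested
    then show ?thesis using parabola_nested_chords_meet[OF z] ord by auto
  next
    case enclosing
    then show ?thesis using parabola_nested_chords_meet[OF z(2,1)] ord by auto
  next
    case left
    then have "Re z = of_int j" using \<open>Re z \<le> of_int j\<close> \<open>of_int k \<le> Re z\<close> by linarith
    then show ?thesis using parabola_chord_end(2)[OF z(1)] by simp
  next
    case right
    then have "Re z = of_int i" using \<open>Re z \<le> of_int l\<close> \<open>of_int i \<le> Re z\<close> by linarith
    then show ?thesis using parabola_chord_end(1)[OF z(1)] by simp
  qed
qed

context noncrossing_labelling
begin

definition convex_position :: "'a \<Rightarrow> complex" where
  "convex_position = parabola \<circ> inv_into {0..<n} c"

lemma convex_position_label: "i \<in> {0..<n} \<Longrightarrow> convex_position (c i) = parabola i"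
  using inj_on_window[of 0] by (simp add: convex_position_def)

lemma vertex_labelE:
  assumes "u \<in> pverts G"
  obtains i where "i \<in> {0..<n}" "u = c i"
  using bij_betw_imp_surj_on[OF bij_betw_window[of 0]] assms that by (metis add_0 imageE)

lemma edge_labelE:
  assumes "adj u v"
  obtains i j where "i \<in> {0..<n}" "j \<in> {0..<n}" "i < j" "i \<frown> j" "{u, v} = {c i, c j}"
    "closed_segment (convex_position u) (convex_position v) =
      closed_segment (parabola i) (parabola j)"
proof -
  obtain i j where ij: "i \<in> {0..<n}" "u = c i" "j \<in> {0..<n}" "v = c j"
    using wellformed'[OF assms] by (metis vertex_labelE)
  show thesis
  proof (cases i j rule: linorder_cases)
    case less
    then show thesis using that[of i j] ij assms by (simp add: convex_position_label)
  next
    case equal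
    then show thesis using no_loops' assms ij by blast
  next
    case greater
    then show thesis
      using that[of j i] ij assms label_adj_commute
      by (simp add: convex_position_label insert_commute closed_segment_commute)
  qed
qed

lemma edges_meet_in_vertices:
  assumes uv: "adj u v" and xy: "adj x y" and neq: "{u, v} \<noteq> {x, y}"
  shows "closed_segment (convex_position u) (convex_position v) \<inter>
    closed_segment (convex_position x) (convex_position y) \<subseteq> convex_position ` pverts G"
proof -
  obtain i j where ij: "i \<in> {0..<n}" "j \<in> {0..<n}" "i < j" "i \<frown> j" "{u, v} = {c i, c j}"
    and chord_ij: "closed_segment (convex_position u) (convex_position v) =
      closed_segment (parabola i) (parabola j)"
    using uv by (rule edge_labelE)
  obtain k l where kl: "k \<in> {0..<n}" "l \<in> {0..<n}" "k < l" "k \<frown> l" "{x, y} = {c k, c l}"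
    and chord_kl: "closed_segment (convex_position x) (convex_position y) =
      closed_segment (parabola k) (parabola l)"
    using xy by (rule edge_labelE)
  have "\<not> (i < k \<and> k < j \<and> j < l)" "\<not> (k < i \<and> i < l \<and> l < j)"
    using noncrossing[of i k j l] noncrossing[of k i l j] ij(1,2,4) kl(1,2,4) by auto
  moreover have "(i, j) \<noteq> (k, l)" using neq ij(5) kl(5) by auto
  ultimately have "closed_segment (parabola i) (parabola j) \<inter>
      closed_segment (parabola k) (parabola l) \<subseteq> parabola ` {i, j, k, l}"
    using parabola_noncrossing_chords_meet ij(3) kl(3) by blast
  also have "\<dots> = convex_position ` {c i, c j, c k, c l}"
    using ij(1,2) kl(1,2) by (simp add: convex_position_label)
  also have "\<dots> \<subseteq> convex_position ` pverts G"
    using range_label by blast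
  finally show ?thesis
    unfolding chord_ij chord_kl .
qed

lemma plane_embedding_convex_position:
  "plane_embedding G convex_position (\<lambda>S. convex hull (convex_position ` S))"
proof (rule plane_embedding_straight_line)
  show "pair_graph G" by (rule pair_graph)
  show "inj_on convex_position (pverts G)"
    by (auto simp: inj_on_def convex_position_label elim!: vertex_labelE)
next
  fix u v w assume "adj u v" "w \<in> pverts G"
    and on: "convex_position w \<in> closed_segment (convex_position u) (convex_position v)"
  obtain i j where ij: "{u, v} = {c i, c j}"
    and chord: "closed_segment (convex_position u) (convex_position v) =
      closed_segment (parabola i) (parabola j)"
    using \<open>adj u v\<close> by (rule edge_labelE)
  obtain k where k: "k \<in> {0..<n}" "w = c k"
    using \<open>w \<in> pverts G\<close> by (rule vertex_labelE)
  have "parabola k \<in> closed_segment (parabola i) (parabola j)"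
    using on unfolding chord k(2) convex_position_label[OF k(1)] .
  then have "k = i \<or> k = j" by (rule parabola_on_chord)
  then show "w = u \<or> w = v" using ij k(2) by auto
qed (rule edges_meet_in_vertices)

lemma noncrossing_imp_outerplanar: "outerplanar G"
  using plane_embedding_convex_position
proof (rule outerplanar_straight_lineI)
  show "convex_position ` pverts G \<subseteq> frontier {z. (Re z)\<^sup>2 \<le> Im z}"
    by (auto simp: convex_position_def parabola_in_frontier)
qed (rule pair_graph convex_above_parabola closed_above_parabola)+

end

theorem theorem4p1:
  fixes G :: "'a pair_pre_digraph"
  assumes "pair_graph G"
    and "k_connected 2 (with_proj G)"
    and "induced_free (with_proj (complete_bipartite_graph 1 3)) (with_proj G)"
    and "minor_free (with_proj (complete_graph 4)) (with_proj G)"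
  shows "outerplanar G \<and>
    ((\<exists>d\<ge>1. digraph_iso (with_proj G) (with_proj (graph_Z d)) \<or>
            digraph_iso (with_proj G) (graph_Zstar d)) \<or>
     (\<exists>t\<ge>3. \<exists>H \<in> graphs_S t. digraph_iso (with_proj G) (with_proj H)))"
proof -
  interpret pair_graph G by fact
  interpret two_connected_claw_K4_free_graph G
    by unfold_locales (fact assms)+
  obtain c n where "claw_free_noncrossing_labelling G c n"
    using claw_free_noncrossing_labelling_exists by blast
  then interpret claw_free_noncrossing_labelling G c n .
  show ?thesis
    using noncrossing_imp_outerplanar iso_zigzag_or_sun by blast
qed

end
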